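(* Any dense pure S-ring over a CG-ring of odd characteristic is cyclotomic.
   Context: All rings are finite, commutative, with identity. For a ring $R$, $R^+$ is the additive group, $R^\times$ the group of units. For a prime $p$ dividing $|R|$, $R_p$ is the $p$-component of $R$ (the subring whose additive group is the Sylow $p$-subgroup of $R^+$). $R$ is a CG-ring if every $R_p$ is a Galois ring, i.e. a local ring with radical $pR_p$. S-ring over a finite group $G$: a subring $\mathcal A$ of $\mathbb Z G$ having a $\mathbb Z$-basis consisting of the elements $\sum_{x\in X}x$, where $X$ runs over a partition $\mathcal S(\mathcal A)$ of $G$ into non-empty sets (basic sets) such that $\{1\}\in\mathcal S(\mathcal A)$ and $X\in\mathcal S(\mathcal A)\Rightarrow X^{-1}\in\mathcal S(\mathcal A)$. S-ring over the ring $R$: an S-ring $\mathcal A$ over $R^+$ such that $uX\in\mathcal S(\mathcal A)$ for all $X\in\mathcal S(\mathcal A)$, $u\in R^\times$. $\mathcal A$ is dense if every ideal of $R$ is a union of basic sets of $\mathcal A$. For $X\subset R$, $I_{\rm L}(X)$ is the largest ideal $I$ of $R$ with $X+I=X$; $\mathcal A$ is pure if $I_{\rm L}(X)=0$ for some (equivalently, every) $X\in\mathcal S(\mathcal A)$ with $X\cap R^\times\ne\emptyset$. $\mathcal A$ is cyclotomic if there is a subgroup $K\le R^\times$ such that $\mathcal S(\mathcal A)$ is the set of orbits of $K$ acting on $R$ by multiplication. *)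

theory Defs
  imports "HOL-Algebra.Algebra" "HOL-Library.Disjoint_Sets" "HOL-Library.Indicator_Function"
begin

definition sylow_part :: "('a, 'm) ring_scheme \<Rightarrow> nat \<Rightarrow> 'a set" where
  "sylow_part R p =
     (THE P. subgroup P (add_monoid R) \<and> card P = p ^ multiplicity p (order R))"

text \<open>The component has its own identity, which differs from that of \<open>R\<close> unless
  the order of \<open>R\<close> is a power of \<open>p\<close>.\<close>

definition ring_component :: "('a, 'm) ring_scheme \<Rightarrow> nat \<Rightarrow> ('a, 'm) ring_scheme" where
  "ring_component R p =
     R\<lparr>carrier := sylow_part R p,
       one := (THE e. e \<in> sylow_part R p \<and> (\<forall>x\<in>sylow_part R p. e \<otimes>\<^bsub>R\<^esub> x = x))\<rparr>"

definition local_ring :: "('a, 'm) ring_scheme \<Rightarrow> bool" where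
  "local_ring R \<longleftrightarrow> cring R \<and> (\<exists>!M. maximalideal M R)"

definition jacobson_radical :: "('a, 'm) ring_scheme \<Rightarrow> 'a set" where
  "jacobson_radical R = carrier R \<inter> \<Inter>{M. maximalideal M R}"

definition galois_ring :: "nat \<Rightarrow> ('a, 'm) ring_scheme \<Rightarrow> bool" where
  "galois_ring p R \<longleftrightarrow>
     local_ring R \<and> jacobson_radical R = (\<lambda>x. add_pow R p x) ` carrier R"

definition CG_ring :: "('a, 'm) ring_scheme \<Rightarrow> bool" where
  "CG_ring R \<longleftrightarrow> cring R \<and> finite (carrier R) \<and>
     (\<forall>p. Factorial_Ring.prime p \<and> p dvd order R \<longrightarrow> galois_ring p (ring_component R p))"

definition ring_char :: "('a, 'm) ring_scheme \<Rightarrow> nat" where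
  "ring_char R = group.ord (add_monoid R) \<one>\<^bsub>R\<^esub>"

text \<open>An element of the integral group ring is its coefficient function, extended by \<open>0\<close>
  outside the carrier.  The product is the usual convolution (for finite groups).\<close>

definition int_group_ring :: "('a, 'm) monoid_scheme \<Rightarrow> ('a \<Rightarrow> int) ring" where
  "int_group_ring G =
     \<lparr>carrier = {f. \<forall>x. x \<notin> carrier G \<longrightarrow> f x = 0},
      monoid.mult = (\<lambda>f g x. \<Sum>(y, z) \<in> {(y, z) \<in> carrier G \<times> carrier G. y \<otimes>\<^bsub>G\<^esub> z = x}. f y * g z),
      one = indicator {\<one>\<^bsub>G\<^esub>},
      ring.zero = (\<lambda>x. 0),
      add = (\<lambda>f g x. f x + g x)\<rparr>"

text \<open>\<open>B\<close> is a finite basis of the additive group \<open>A\<close>: every element of \<open>A\<close> is an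
  integral combination of \<open>B\<close> with unique coefficients.\<close>

definition is_int_basis :: "('a \<Rightarrow> int) set \<Rightarrow> ('a \<Rightarrow> int) set \<Rightarrow> bool" where
  "is_int_basis A B \<longleftrightarrow> finite B \<and> B \<subseteq> A \<and>
     (\<forall>a\<in>A. \<exists>!c. c \<in> B \<rightarrow>\<^sub>E (UNIV :: int set) \<and> a = (\<lambda>x. \<Sum>b\<in>B. c b * b x))"

text \<open>\<open>S\<close> is the set of basic sets of \<open>A\<close>; it is determined by \<open>A\<close>.  The indicator function
  of \<open>Y\<close> is the formal sum of the elements of \<open>Y\<close>.\<close>

definition S_ring :: "('a, 'm) monoid_scheme \<Rightarrow> ('a \<Rightarrow> int) set \<Rightarrow> 'a set set \<Rightarrow> bool" where
  "S_ring G A S \<longleftrightarrow>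
     group G \<and> finite (carrier G) \<and>
     subring A (int_group_ring G) \<and>
     partition_on (carrier G) S \<and>
     is_int_basis A (indicator ` S) \<and>
     {\<one>\<^bsub>G\<^esub>} \<in> S \<and>
     (\<forall>Y\<in>S. m_inv G ` Y \<in> S)"

definition S_ring_over_ring ::
    "('a, 'm) ring_scheme \<Rightarrow> ('a \<Rightarrow> int) set \<Rightarrow> 'a set set \<Rightarrow> bool" where
  "S_ring_over_ring R A S \<longleftrightarrow>
     S_ring (add_monoid R) A S \<and> (\<forall>Y\<in>S. \<forall>u\<in>Units R. u <#\<^bsub>R\<^esub> Y \<in> S)"

text \<open>Density, purity and being cyclotomic depend on an S-ring only through its basic sets.\<close>

definition dense_basic_sets :: "('a, 'm) ring_scheme \<Rightarrow> 'a set set \<Rightarrow> bool" where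
  "dense_basic_sets R S \<longleftrightarrow> (\<forall>I. ideal I R \<longrightarrow> (\<exists>T\<subseteq>S. I = \<Union>T))"

definition I_L :: "('a, 'm) ring_scheme \<Rightarrow> 'a set \<Rightarrow> 'a set" where
  "I_L R Y = (GREATEST I. ideal I R \<and> Y <+>\<^bsub>R\<^esub> I = Y)"

definition pure_basic_sets :: "('a, 'm) ring_scheme \<Rightarrow> 'a set set \<Rightarrow> bool" where
  "pure_basic_sets R S \<longleftrightarrow> (\<exists>Y\<in>S. Y \<inter> Units R \<noteq> {} \<and> I_L R Y = {\<zero>\<^bsub>R\<^esub>})"

definition cyclotomic_basic_sets :: "('a, 'm) ring_scheme \<Rightarrow> 'a set set \<Rightarrow> bool" where
  "cyclotomic_basic_sets R S \<longleftrightarrow>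
     (\<exists>K. subgroup K (units_of R) \<and>
          S = orbits ((units_of R)\<lparr>carrier := K\<rparr>) (carrier R) (\<lambda>u x. u \<otimes>\<^bsub>R\<^esub> x))"

end

theory Submission
  imports Complex_Main "HOL-Number_Theory.Cong" Defs
begin

text \<open>
  Write \<open>H\<^sub>p\<close> for the annihilator of the prime \<open>p\<close>; in a CG-ring it is the least non-zero ideal of
  the \<open>p\<close>-component.  The basic set \<open>K\<close> of \<open>\<one>\<close> is a group of units whose translates are the basic sets
  of the units, and purity says that no coset \<open>\<one> + H\<^sub>p\<close> lies in \<open>K\<close>.

  Functions are compared through their Fourier transforms with respect to an additive character \<open>\<chi>\<close>
  that is non-trivial on every \<open>H\<^sub>p\<close>.  Fix a non-zero \<open>t\<^sub>p\<close> in each \<open>H\<^sub>p\<close>.  If \<open>f n \<noteq> 0\<close>, while \<open>f\<close>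
  vanishes at \<open>n\<close> plus the sum of any non-empty subfamily of the \<open>t\<^sub>p\<close>, then the transform of \<open>f\<close> is
  non-zero at some unit.  As \<open>p\<close> is odd and no \<open>n + H\<^sub>p\<close> lies in \<open>n K\<close>, suitable \<open>t\<^sub>p\<close> exist when all
  components of \<open>n\<close> are non-zero and \<open>f\<close> is supported on two cosets of a subgroup of \<open>K\<close>, so such an \<open>f\<close>
  vanishes at \<open>n\<close> if its transform vanishes at all units.
  Applied to indicators of basic sets and of \<open>L\<close>, the group of frequencies at which all basic sets have
  the same character sums as at \<open>\<one>\<close>, this yields \<open>L = K\<close>, and then that the basic set of \<open>n\<close> is
  \<open>n K\<close>.  An element with vanishing components is reached by projection from \<open>n + e\<close>, with \<open>e\<close> the
  identity of such a component.
\<close>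

section \<open>Finite commutative rings and their primary components\<close>

text \<open>Character sums of basic sets can be compared only at unit frequencies: the sum of
  \<open>A\<close> at \<open>w b\<close> is that of \<open>w A\<close> at \<open>b\<close>, and only
  multiplication by units is known to permute basic sets. The main obstacle is the avoidance
  hypothesis of the uniqueness principle. Purity speaks about \<one> only, whereas a non-unit
  \<open>n\<close> may have a stabiliser in \<open>K\<close>, and \<open>n K\<close> might contain
  \<open>n + H\<^sub>p\<close> although \<open>K\<close> does not contain
  \<open>\<one> + H\<^sub>p\<close>. This is excluded by dividing \<open>n\<close> by one prime at a
  time and lifting the coset with powers of a single unit; if that prime is \<open>p\<close> itself,
  a second-order term appears with coefficient \<open>p choose 2\<close>, which an odd
  \<open>p\<close> divides. Oddness enters once more in choosing \<open>t\<^sub>p\<close>: it has to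
  avoid two cosets of a group, and if a vector \<open>h\<close> outside the group fails, then
  \<open>2 h\<close> succeeds. The group \<open>L\<close> is the basic set of \<one> in the dual
  partition of the frequencies. \<open>L \<subseteq> K\<close> comes before
  \<open>K \<subseteq> L\<close>, since cosets of \<open>L\<close> inherit the avoidance property
  from those of \<open>K\<close>.\<close>

lemma (in cring) add_diff:
  assumes "x \<in> carrier R" "y \<in> carrier R"
  shows "y \<oplus> (x \<ominus> y) = x"
  using assms by (simp add: a_minus_def a_comm[of x] r_neg2)

lemma (in cring) add_diff_diff:
  assumes "x \<in> carrier R" "y \<in> carrier R" "z \<in> carrier R"
  shows "x = y \<oplus> (z \<oplus> (x \<ominus> y \<ominus> z))"
  using assms by (simp add: add_diff)

locale finite_cring = cring R for R (structure) +
  assumes finite_carrier: "finite (carrier R)"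
begin

section \<open>The image of the integers in the ring\<close>

definition emb :: "nat \<Rightarrow> 'a" where
  "emb k = [k] \<cdot> \<one>"

lemma emb_closed [simp, intro]: "emb k \<in> carrier R"
  by (simp add: emb_def)

lemma emb_0 [simp]: "emb 0 = \<zero>"
  by (simp add: emb_def)

lemma emb_1 [simp]: "emb 1 = \<one>" "emb (Suc 0) = \<one>"
  by (simp_all add: emb_def)

lemma emb_add: "emb (j + k) = emb j \<oplus> emb k"
  by (simp add: emb_def add.nat_pow_mult)

lemma emb_l_mult: "x \<in> carrier R \<Longrightarrow> emb k \<otimes> x = [k] \<cdot> x"
  by (simp add: emb_def add_pow_ldistr)

lemma emb_mult: "emb (j * k) = emb j \<otimes> emb k"
proof -
  have "[(j * k)] \<cdot> \<one> = [j] \<cdot> ([k] \<cdot> \<one>)"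
    by (metis add.nat_pow_pow mult.commute one_closed)
  then show ?thesis using emb_l_mult[of "emb k" j] by (simp add: emb_def)
qed

lemma order_add_monoid: "order (add_monoid R) = order R"
  by (simp add: order_def)

lemma emb_order: "order R dvd k \<Longrightarrow> emb k = \<zero>"
proof -
  assume "order R dvd k"
  then obtain j where k: "k = order R * j" by blast
  have "emb (order R) = \<zero>"
    using add.pow_order_eq_1[of \<one>] by (simp add: emb_def order_add_monoid)
  then show ?thesis by (simp add: k emb_mult)
qed

lemma order_pos: "order R > 0"
  using finite_carrier zero_closed by (auto simp: order_def card_gt_0_iff)

lemma emb_cong: "[j = k] (mod order R) \<Longrightarrow> emb j = emb k"
proof (induction j k rule: linorder_wlog)
  case (le a b)
  then have "order R dvd b - a" by (metis cong_sym cong_altdef_nat)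
  then have "emb (b - a) = \<zero>" by (rule emb_order)
  then have "emb (a + (b - a)) = emb a" by (simp only: emb_add emb_closed r_zero)
  then show ?case using le by simp
next
  case (sym a b)
  then show ?case by (metis cong_sym)
qed

section \<open>Elements killed by a prime: the ideals \<open>H\<^sub>p\<close>\<close>

definition socle :: "nat \<Rightarrow> 'a set" where
  "socle p = {x \<in> carrier R. emb p \<otimes> x = \<zero>}"

lemma socle_carrier [dest]: "x \<in> socle p \<Longrightarrow> x \<in> carrier R"
  by (simp add: socle_def)

lemma socle_emb: "x \<in> socle p \<Longrightarrow> emb p \<otimes> x = \<zero>"
  by (simp add: socle_def)

lemma socle_zero [simp]: "\<zero> \<in> socle p"
  by (simp add: socle_def)

lemma socle_add [intro]: "x \<in> socle p \<Longrightarrow> y \<in> socle p \<Longrightarrow> x \<oplus> y \<in> socle p"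
  by (simp add: socle_def r_distr)

lemma socle_minus [intro]: "x \<in> socle p \<Longrightarrow> \<ominus> x \<in> socle p"
  by (simp add: socle_def r_minus)

lemma socle_mult [intro]: "x \<in> socle p \<Longrightarrow> y \<in> carrier R \<Longrightarrow> x \<otimes> y \<in> socle p"
  by (simp add: socle_def flip: m_assoc)

lemma socle_l_mult [intro]: "x \<in> socle p \<Longrightarrow> y \<in> carrier R \<Longrightarrow> y \<otimes> x \<in> socle p"
  by (metis m_comm socle_carrier socle_mult)

lemma socle_emb_dvd: "x \<in> socle p \<Longrightarrow> p dvd k \<Longrightarrow> emb k \<otimes> x = \<zero>"
proof -
  assume x: "x \<in> socle p" and "p dvd k"
  then obtain j where k: "k = j * p" by (metis dvdE mult.commute)
  show "emb k \<otimes> x = \<zero>"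
    using socle_carrier[OF x] unfolding k emb_mult by (simp add: m_assoc socle_emb[OF x])
qed

lemma socle_ideal: "ideal (socle p) R"
proof (rule idealI)
  show "ring R" by (rule ring_axioms)
  show "subgroup (socle p) (add_monoid R)"
  proof (rule add.subgroupI)
    show "socle p \<noteq> {}" using socle_zero by blast
  qed (auto simp flip: a_inv_def)
qed auto

definition primes :: "nat set" where
  "primes = {p. Factorial_Ring.prime p \<and> p dvd order R}"

lemma primes_prime: "p \<in> primes \<Longrightarrow> Factorial_Ring.prime p"
  by (simp add: primes_def)

lemma finite_primes: "finite primes"
  by (rule finite_subset[of _ "{..order R}"]) (use order_pos dvd_imp_le in \<open>auto simp: primes_def\<close>)

lemma subgroup_card_emb:
  assumes H: "subgroup H (add_monoid R)" and x: "x \<in> H"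
  shows "emb (card H) \<otimes> x = \<zero>"
proof -
  interpret H: group "(add_monoid R)\<lparr>carrier := H\<rparr>"
    by (rule add.subgroup_imp_group[OF H])
  have HR: "H \<subseteq> carrier R" using subgroup.subset[OF H] by simp
  have eq: "x [^]\<^bsub>add_monoid R\<^esub> card H = x [^]\<^bsub>(add_monoid R)\<lparr>carrier := H\<rparr>\<^esub> card H"
    by (simp add: nat_pow_def)
  have "[card H] \<cdot> x = \<zero>"
    unfolding add_pow_def eq using H.pow_order_eq_1[of x] x by (simp add: order_def)
  then show ?thesis using x HR by (auto simp: emb_l_mult)
qed

text \<open>Cauchy's theorem, taken from Sylow's with exponent 1: a subgroup of order
  \<open>p\<close> is killed by \<open>p\<close> and has a non-zero element.\<close>

lemma socle_nontrivial:
  assumes "p \<in> primes" obtains x where "x \<in> socle p" "x \<noteq> \<zero>"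
proof -
  have p: "Factorial_Ring.prime p" and "p dvd order R" using assms by (simp_all add: primes_def)
  then obtain m where m: "order R = p ^ 1 * m" by (metis dvdE power_one_right)
  obtain H where H: "subgroup H (add_monoid R)" "card H = p ^ 1"
  proof -
    have "order (add_monoid R) = p ^ 1 * m" unfolding order_add_monoid by (rule m)
    moreover have "finite (carrier (add_monoid R))" using finite_carrier by simp
    ultimately show thesis
      using sylow_thm[OF p add.is_group, of 1 m] that by metis
  qed
  have HR: "H \<subseteq> carrier R" using subgroup.subset[OF H(1)] by simp
  have "card H > 1" unfolding H(2) power_one_right using p by (rule prime_gt_1_nat)
  then have "\<not> H \<subseteq> {\<zero>}"
    using card_mono[of "{\<zero>}" H] by fastforce
  then obtain x where x: "x \<in> H" "x \<noteq> \<zero>" by blast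
  have "emb p \<otimes> x = \<zero>" using subgroup_card_emb[OF H(1) x(1)] H(2) by simp
  then have "x \<in> socle p" using x(1) HR by (auto simp: socle_def)
  then show thesis using x(2) by (rule that)
qed

lemma emb_eq_zero_iff: "x \<in> carrier R \<Longrightarrow> emb k \<otimes> x = \<zero> \<longleftrightarrow> add.ord x dvd k"
  using add.pow_eq_id[of x k] by (simp add: emb_l_mult)

text \<open>If the additive order of \<open>x\<close> is \<open>p * k\<close>, then
  \<open>emb k \<otimes> x\<close> has additive order \<open>p\<close>. This reduces questions about
  non-zero elements to the socles.\<close>

lemma socle_below:
  assumes "x \<in> carrier R" "x \<noteq> \<zero>"
  obtains p r where "p \<in> primes" "r \<in> carrier R" "x \<otimes> r \<in> socle p" "x \<otimes> r \<noteq> \<zero>"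
proof -
  define n where "n = add.ord x"
  have eq: "emb k \<otimes> x = \<zero> \<longleftrightarrow> n dvd k" for k
    unfolding n_def by (rule emb_eq_zero_iff[OF assms(1)])
  have "n \<noteq> 1" using eq[of 1] assms by simp
  then obtain p where p: "Factorial_Ring.prime p" "p dvd n" by (metis prime_factor_nat)
  have "n dvd order R" by (metis eq emb_order dvd_refl l_null assms(1))
  with p have pP: "p \<in> primes" by (auto simp: primes_def)
  obtain k where k: "n = p * k" using p by blast
  have "n > 0" using \<open>n dvd order R\<close> order_pos by (auto intro: Nat.gr0I)
  then have "\<not> n dvd k"
    using k prime_gt_1_nat[OF p(1)] by (auto dest!: dvd_imp_le)
  then have "x \<otimes> emb k \<noteq> \<zero>" using eq[of k] assms by (simp add: m_comm)
  moreover have "emb p \<otimes> (x \<otimes> emb k) = \<zero>"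
    using eq[of n] assms unfolding k by (simp add: emb_mult m_ac)
  ultimately show thesis using that[OF pP, of "emb k"] assms by (simp add: socle_def)
qed

text \<open>A Chinese remainder solution, so that \<open>idem p\<close> below is the identity of the \<open>p\<close>-component written
  as an integer multiple of \<open>\<one>\<close>.\<close>

definition idem_index :: "nat \<Rightarrow> nat" where
  "idem_index p = (SOME c. [c = 1] (mod p ^ multiplicity p (order R)) \<and>
     [c = 0] (mod order R div p ^ multiplicity p (order R)))"

definition idem :: "nat \<Rightarrow> 'a" where
  "idem p = emb (idem_index p)"

lemma idem_closed [simp, intro]: "idem p \<in> carrier R"
  by (simp add: idem_def)

lemma order_decomp:
  assumes "p \<in> primes"
  obtains a m where "a = multiplicity p (order R)" "a > 0" "order R = p ^ a * m" "coprime p m"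
     "[idem_index p = 1] (mod p ^ a)" "m dvd idem_index p"
proof -
  define a where "a = multiplicity p (order R)"
  define m where "m = order R div p ^ a"
  have p: "Factorial_Ring.prime p" using assms by (simp add: primes_def)
  have o: "order R = p ^ a * m" by (simp add: m_def a_def multiplicity_dvd)
  have a0: "a > 0" using assms p order_pos
    by (simp add: a_def primes_def prime_multiplicity_gt_zero_iff)
  have nd: "\<not> p dvd m"
    unfolding m_def a_def using order_pos p by (intro multiplicity_decompose) auto
  then have cop: "coprime p m" using p by (rule prime_imp_coprime[rotated])
  then have "coprime (p ^ a) m" by simp
  then obtain c where "[c = 1] (mod p ^ a)" "[c = 0] (mod m)"
    using binary_chinese_remainder_nat by blast
  then have "\<exists>c. [c = 1] (mod p ^ a) \<and> [c = 0] (mod m)" by blast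
  then have "[idem_index p = 1] (mod p ^ a) \<and> [idem_index p = 0] (mod m)"
    unfolding idem_index_def m_def a_def by (rule someI_ex)
  then show thesis using that[OF a_def a0 o cop] by (auto simp: cong_0_iff)
qed

lemma idem_index_eq:
  assumes "p \<in> primes"
  shows "\<exists>k l. idem_index p + k * p = 1 + l * p"
proof -
  obtain a where a: "a > 0" "[idem_index p = 1] (mod p ^ a)"
    using order_decomp[OF assms] by metis
  have "p dvd p ^ a" using a by (simp add: dvd_power)
  then have "[1 = idem_index p] (mod p)"
    using a cong_dvd_modulus_nat cong_sym by blast
  then show ?thesis unfolding cong_iff_lin_nat by blast
qed

lemma idem_socle: "p \<in> primes \<Longrightarrow> x \<in> socle p \<Longrightarrow> idem p \<otimes> x = x"
proof -
  assume p: "p \<in> primes" and x: "x \<in> socle p"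
  obtain k l where "idem_index p + k * p = 1 + l * p"
    using idem_index_eq[OF p] by blast
  then have "emb (idem_index p + k * p) \<otimes> x = emb (1 + l * p) \<otimes> x" by simp
  then show ?thesis
    using x socle_carrier[OF x] socle_emb_dvd[OF x, of "k * p"] socle_emb_dvd[OF x, of "l * p"]
    by (simp add: emb_add l_distr idem_def del: One_nat_def emb_1(2))
qed

lemma idem_socle_other:
  assumes "p \<in> primes" "q \<in> primes" "p \<noteq> q" "x \<in> socle q"
  shows "idem p \<otimes> x = \<zero>"
proof -
  obtain a m where a: "order R = p ^ a * m" "m dvd idem_index p"
    using order_decomp[OF assms(1)] by metis
  have "\<not> q dvd p ^ a" using assms by (metis primes_prime prime_dvd_power primes_dvd_imp_eq)
  then have "q dvd m" using assms(2) a(1) by (auto simp: primes_def prime_dvd_mult_iff)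
  then show ?thesis using a assms socle_emb_dvd unfolding idem_def by (meson dvd_trans)
qed

lemma idem_nilpotent:
  assumes "p \<in> primes"
  shows "emb (p ^ multiplicity p (order R)) \<otimes> idem p = \<zero>"
proof -
  obtain a m where a: "a = multiplicity p (order R)" "order R = p ^ a * m" "m dvd idem_index p"
    using order_decomp[OF assms(1)] by metis
  then show ?thesis unfolding idem_def
    by (metis emb_mult emb_order mult_dvd_mono dvd_refl)
qed

lemma idem_idem: "p \<in> primes \<Longrightarrow> idem p \<otimes> idem p = idem p"
proof -
  assume p: "p \<in> primes"
  obtain a m where a: "order R = p ^ a * m" "coprime p m" "[idem_index p = 1] (mod p ^ a)" "m dvd idem_index p"
    using order_decomp[OF p] by metis
  have "[idem_index p * idem_index p = idem_index p * 1] (mod p ^ a)"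
    using a(3) by (rule cong_scalar_left)
  moreover have "[idem_index p * idem_index p = idem_index p * 1] (mod m)"
    using a(4) by (metis cong_0_iff cong_sym cong_trans dvd_mult2 mult_1_right)
  ultimately have "[idem_index p * idem_index p = idem_index p] (mod order R)"
    using a by (simp add: coprime_cong_mult_nat)
  then show ?thesis unfolding idem_def emb_mult[symmetric] by (rule emb_cong)
qed

lemma idem_orthogonal: "p \<in> primes \<Longrightarrow> q \<in> primes \<Longrightarrow> p \<noteq> q \<Longrightarrow> idem p \<otimes> idem q = \<zero>"
proof -
  assume p: "p \<in> primes" and q: "q \<in> primes" and pq: "p \<noteq> q"
  obtain a m where a: "order R = p ^ a * m" "coprime p m" "m dvd idem_index p"
    using order_decomp[OF p] by metis
  obtain b n where b: "order R = q ^ b * n" "coprime q n" "n dvd idem_index q"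
    using order_decomp[OF q] by metis
  have "coprime (p ^ a) (q ^ b)" using p q pq
    by (simp add: primes_coprime primes_prime)
  moreover have "p ^ a dvd q ^ b * n" using a b by (metis dvd_triv_left)
  ultimately have "p ^ a dvd n" by (simp add: coprime_dvd_mult_right_iff)
  then have "p ^ a dvd idem_index q" using b(3) dvd_trans by blast
  then have "m * p ^ a dvd idem_index p * idem_index q"
    using a(3) by (rule mult_dvd_mono[rotated])
  then have "order R dvd idem_index p * idem_index q"
    by (simp add: a(1) mult.commute)
  then show ?thesis unfolding idem_def emb_mult[symmetric] by (rule emb_order)
qed

text \<open>\<open>idem_index p\<close> is 1 modulo \<open>p\<close>. The lemma serves to lift
  divisibility by \<open>p\<close> from the \<open>p\<close>-component to the whole ring.\<close>

lemma idem_complement: "p \<in> primes \<Longrightarrow> \<exists>y\<in>carrier R. \<one> \<ominus> idem p = emb p \<otimes> y"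
proof -
  assume p: "p \<in> primes"
  obtain k l where "idem_index p + k * p = 1 + l * p"
    using idem_index_eq[OF p] by blast
  then have "emb (idem_index p + k * p) = emb (1 + l * p)" by simp
  then have *: "idem p \<oplus> emb k \<otimes> emb p = \<one> \<oplus> emb l \<otimes> emb p"
    unfolding emb_add emb_mult idem_def emb_1 .
  have eq: "\<one> \<ominus> i = q \<otimes> (a \<ominus> b)" if e: "i \<oplus> a \<otimes> q = \<one> \<oplus> b \<otimes> q"
    and c: "i \<in> carrier R" "a \<in> carrier R" "b \<in> carrier R" "q \<in> carrier R" for i a b q
  proof -
    have "i \<oplus> q \<otimes> (a \<ominus> b) = (i \<oplus> a \<otimes> q) \<oplus> \<ominus> (b \<otimes> q)"
      using c by (simp add: a_minus_def r_distr r_minus a_assoc m_comm[of q])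
    also have "\<dots> = i \<oplus> (\<one> \<ominus> i)"
      unfolding e using c by (simp add: add_diff a_assoc r_neg)
    finally have "i \<oplus> q \<otimes> (a \<ominus> b) = i \<oplus> (\<one> \<ominus> i)" .
    then have "q \<otimes> (a \<ominus> b) = \<one> \<ominus> i"
      by (rule add.l_cancel) (use c in simp_all)
    then show ?thesis by (rule sym)
  qed
  show ?thesis
    using eq[OF * idem_closed emb_closed emb_closed emb_closed] by blast
qed

text \<open>A non-zero difference has a non-zero multiple in some \<open>socle p\<close>, where
  \<open>idem p\<close> acts as the identity. This replaces a proof that the idempotents sum to
  \<one>.\<close>

lemma idem_ext:
  assumes "x \<in> carrier R" "y \<in> carrier R" "\<And>p. p \<in> primes \<Longrightarrow> idem p \<otimes> x = idem p \<otimes> y"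
  shows "x = y"
proof (rule ccontr)
  assume "x \<noteq> y"
  then have d: "x \<ominus> y \<in> carrier R" "x \<ominus> y \<noteq> \<zero>" using assms(1,2) by simp_all
  obtain p r where p: "p \<in> primes" and r: "r \<in> carrier R" and
    s: "(x \<ominus> y) \<otimes> r \<in> socle p" "(x \<ominus> y) \<otimes> r \<noteq> \<zero>"
    by (rule socle_below[OF d])
  have "idem p \<otimes> (x \<ominus> y) = idem p \<otimes> x \<ominus> idem p \<otimes> y"
    using assms(1,2) by (simp add: a_minus_def r_distr r_minus)
  then have "idem p \<otimes> (x \<ominus> y) = \<zero>"
    using assms(1,2) assms(3)[OF p] by (simp add: a_minus_def r_neg)
  then have "idem p \<otimes> ((x \<ominus> y) \<otimes> r) = \<zero>"
    using m_assoc[OF idem_closed[of p] d(1) r, symmetric] r by simp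
  then show False using idem_socle[OF p s(1)] s(2) by simp
qed

end

section \<open>Cosets of unit groups in CG-rings of odd characteristic\<close>

text \<open>\<open>galois\<close> states inside \<open>R\<close> that the \<open>p\<close>-component
  is local with radical generated by \<open>p\<close>: as \<open>\<one> \<ominus> idem p\<close> is
  divisible by \<open>p\<close>, an element is divisible by \<open>p\<close> in \<open>R\<close>
  once its \<open>p\<close>-component is.\<close>

locale odd_cg_ring = finite_cring +
  assumes galois: "\<lbrakk>p \<in> primes; x \<in> carrier R\<rbrakk> \<Longrightarrow>
      (\<exists>y\<in>carrier R. x = emb p \<otimes> y) \<or> (\<exists>w\<in>carrier R. x \<otimes> w \<otimes> idem p = idem p)"
    and odd_primes: "p \<in> primes \<Longrightarrow> odd p"
begin

text \<open>Take the largest \<open>i\<close> for which \<open>p ^ i\<close> divides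
  \<open>x\<close>. It exists because the full power of \<open>p\<close> in the order annihilates
  the \<open>p\<close>-component; \<open>galois\<close> then makes the cofactor invertible
  there.\<close>

lemma prime_power_decomp:
  assumes p: "p \<in> primes" and x: "x \<in> carrier R" and nz: "idem p \<otimes> x \<noteq> \<zero>"
  obtains i y w where "y \<in> carrier R" "w \<in> carrier R" "x = emb (p ^ i) \<otimes> y" "y \<otimes> w \<otimes> idem p = idem p"
proof -
  define Q where "Q i \<longleftrightarrow> (\<exists>y\<in>carrier R. x = emb (p ^ i) \<otimes> y)" for i
  have "Q 0" using x by (auto simp: Q_def)
  have "\<not> Q (multiplicity p (order R))"
  proof
    assume "Q (multiplicity p (order R))"
    then obtain y where y: "y \<in> carrier R" "x = emb (p ^ multiplicity p (order R)) \<otimes> y"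
      unfolding Q_def by blast
    have "idem p \<otimes> x = (emb (p ^ multiplicity p (order R)) \<otimes> idem p) \<otimes> y"
      unfolding y(2) using y(1) by (simp add: m_ac)
    then show False using nz y(1) idem_nilpotent[OF p] by simp
  qed
  then have "\<exists>i. Q i \<and> \<not> Q (Suc i)"
    using nat_induct[of Q "multiplicity p (order R)"] \<open>Q 0\<close> by blast
  then obtain i where Qi: "Q i" and nQ: "\<not> Q (Suc i)" by blast
  from Qi obtain y where y: "y \<in> carrier R" "x = emb (p ^ i) \<otimes> y" unfolding Q_def by blast
  have "\<not> (\<exists>z\<in>carrier R. y = emb p \<otimes> z)"
  proof
    assume "\<exists>z\<in>carrier R. y = emb p \<otimes> z"
    then obtain z where "z \<in> carrier R" "y = emb p \<otimes> z" by blast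
    with y have "Q (Suc i)"
      unfolding Q_def by (intro bexI[of _ z]) (simp_all add: emb_mult m_ac)
    with nQ show False ..
  qed
  then obtain w where "w \<in> carrier R" "y \<otimes> w \<otimes> idem p = idem p"
    using galois[OF p y(1)] by blast
  with y that show thesis by blast
qed

text \<open>Up to factors invertible in the \<open>p\<close>-component, \<open>y\<close> and
  \<open>z\<close> are powers of \<open>p\<close>. If the exponent of \<open>y\<close> were the
  larger one, \<open>y\<close> would be a multiple of \<open>emb p \<otimes> z\<close>, which is
  \<zero>; so \<open>y\<close> divides \<open>z\<close>.\<close>

lemma socle_minimal:
  assumes p: "p \<in> primes" and y: "y \<in> socle p" "y \<noteq> \<zero>" and z: "z \<in> socle p"
  shows "\<exists>r\<in>carrier R. z = y \<otimes> r"
proof (cases "z = \<zero>")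
  case True
  then show ?thesis using y by (intro bexI[of _ \<zero>]) auto
next
  case False
  have yc: "y \<in> carrier R" and zc: "z \<in> carrier R" using y z by auto
  obtain i y' w where i: "y' \<in> carrier R" "w \<in> carrier R" "y = emb (p ^ i) \<otimes> y'" "y' \<otimes> w \<otimes> idem p = idem p"
    using prime_power_decomp[OF p yc] idem_socle[OF p y(1)] y(2) by metis
  obtain j z' v where j: "z' \<in> carrier R" "v \<in> carrier R" "z = emb (p ^ j) \<otimes> z'" "z' \<otimes> v \<otimes> idem p = idem p"
    using prime_power_decomp[OF p zc] idem_socle[OF p z(1)] False by metis
  have yi: "emb (p ^ i) \<otimes> idem p = y \<otimes> (w \<otimes> idem p)"
    unfolding i(3) using i(1,2) arg_cong[OF i(4), of "\<lambda>t. emb (p ^ i) \<otimes> t"] by (simp add: m_assoc)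
  have zj: "emb (p ^ j) \<otimes> idem p = z \<otimes> (v \<otimes> idem p)"
    unfolding j(3) using j(1,2) arg_cong[OF j(4), of "\<lambda>t. emb (p ^ j) \<otimes> t"] by (simp add: m_assoc)
  show ?thesis
  proof (cases "i \<le> j")
    case True
    then have pj: "p ^ j = p ^ i * p ^ (j - i)" by (simp flip: power_add)
    have "z = idem p \<otimes> z" using idem_socle[OF p z] by simp
    also have "\<dots> = (emb (p ^ i) \<otimes> idem p) \<otimes> (emb (p ^ (j - i)) \<otimes> z')"
      unfolding j(3) pj emb_mult using j(1) by (simp add: m_ac)
    also have "\<dots> = y \<otimes> (w \<otimes> idem p \<otimes> (emb (p ^ (j - i)) \<otimes> z'))"
      unfolding yi using i(2) j(1) yc by (simp add: m_assoc)
    finally show ?thesis using i(2) j(1) by blast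
  next
    case False
    then have pi: "p ^ i = p ^ j * (p * p ^ (i - j - 1))"
      by (simp flip: power_add power_Suc)
    have "y = idem p \<otimes> y" using idem_socle[OF p y(1)] by simp
    also have "\<dots> = (emb (p ^ j) \<otimes> idem p) \<otimes> (emb p \<otimes> (emb (p ^ (i - j - 1)) \<otimes> y'))"
      unfolding i(3) pi emb_mult using i(1) by (simp add: m_ac)
    also have "\<dots> = (emb p \<otimes> z) \<otimes> (v \<otimes> idem p \<otimes> (emb (p ^ (i - j - 1)) \<otimes> y'))"
      unfolding zj using j(2) i(1) zc by (simp add: m_ac)
    also have "\<dots> = \<zero>" using j(2) i(1) by (simp add: socle_emb[OF z])
    finally show ?thesis using y(2) by simp
  qed
qed

text \<open>Some multiple of \<open>idem p \<otimes> n\<close> is a non-zero element of a socle. As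
  \<open>idem p\<close> fixes it, that socle belongs to \<open>p\<close>, and
  \<open>socle_minimal\<close> leads from it to \<open>h\<close>.\<close>

lemma socle_mult_imp:
  assumes p: "p \<in> primes" and n: "n \<in> carrier R" "idem p \<otimes> n \<noteq> \<zero>" and h: "h \<in> socle p"
  obtains r where "r \<in> carrier R" "h = n \<otimes> r"
proof -
  have c: "idem p \<otimes> n \<in> carrier R" using n by simp
  obtain q r where q: "q \<in> primes" and r: "r \<in> carrier R"
    and s: "idem p \<otimes> n \<otimes> r \<in> socle q" "idem p \<otimes> n \<otimes> r \<noteq> \<zero>"
    using socle_below[OF c n(2)] by metis
  have "idem p \<otimes> (idem p \<otimes> n \<otimes> r) = (idem p \<otimes> idem p) \<otimes> n \<otimes> r"
    using n r by (simp add: m_assoc)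
  then have "idem p \<otimes> (idem p \<otimes> n \<otimes> r) = idem p \<otimes> n \<otimes> r"
    by (simp add: idem_idem[OF p])
  then have "q = p" using idem_socle_other[OF p q _ s(1)] s(2) by auto
  then obtain r' where r': "r' \<in> carrier R" "h = idem p \<otimes> n \<otimes> r \<otimes> r'"
    using socle_minimal[OF p _ s(2) h] s(1) by blast
  then have "h = n \<otimes> (idem p \<otimes> r \<otimes> r')" using n r by (simp add: m_ac)
  with r r' show thesis by (intro that[of "idem p \<otimes> r \<otimes> r'"]) auto
qed

text \<open>An element invertible in every component acts injectively on the finite
  \<open>carrier R\<close>, hence surjectively, and so reaches \<one>.\<close>

lemma nonunit_prime:
  assumes a: "a \<in> carrier R" "a \<notin> Units R"
  obtains p y where "p \<in> primes" "y \<in> carrier R" "a = emb p \<otimes> y"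
proof (rule ccontr)
  assume "\<not> thesis"
  then have w: "\<exists>w\<in>carrier R. a \<otimes> w \<otimes> idem p = idem p" if "p \<in> primes" for p
    using galois[OF that a(1)] that by (metis \<open>\<not> thesis\<close> \<open>\<And>y p. \<lbrakk>p \<in> primes; y \<in> carrier R; a = emb p \<otimes> y\<rbrakk> \<Longrightarrow> thesis\<close>)
  have "inj_on (\<lambda>x. a \<otimes> x) (carrier R)"
  proof (rule inj_onI)
    fix x y assume x: "x \<in> carrier R" and y: "y \<in> carrier R" and eq: "a \<otimes> x = a \<otimes> y"
    show "x = y"
    proof (rule idem_ext[OF x y])
      fix p assume p: "p \<in> primes"
      then obtain v where v: "v \<in> carrier R" "a \<otimes> v \<otimes> idem p = idem p" using w by blast
      have "(a \<otimes> v \<otimes> idem p) \<otimes> x = (a \<otimes> x) \<otimes> (v \<otimes> idem p)"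
        using a(1) v(1) x by (simp add: m_ac)
      also have "\<dots> = (a \<otimes> v \<otimes> idem p) \<otimes> y"
        unfolding eq using a(1) v(1) y by (simp add: m_ac)
      finally show "idem p \<otimes> x = idem p \<otimes> y" unfolding v(2) .
    qed
  qed
  then have "(\<lambda>x. a \<otimes> x) ` carrier R = carrier R"
    using a(1) by (intro endo_inj_surj finite_carrier) auto
  then obtain b where "b \<in> carrier R" "a \<otimes> b = \<one>" using one_closed by (metis imageE)
  then have "a \<in> Units R" using a(1) m_comm unfolding Units_def by (metis (mono_tags, lifting) mem_Collect_eq)
  with a(2) show False ..
qed

text \<open>A non-unit is divisible by some \<open>p\<close> in \<open>primes\<close> and so
  annihilates \<open>socle p\<close>. Frequencies are recognised as units by this test.\<close>

lemma unit_if_socle: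
  assumes "a \<in> carrier R" "\<And>p. p \<in> primes \<Longrightarrow> \<exists>x\<in>socle p. a \<otimes> x \<noteq> \<zero>"
  shows "a \<in> Units R"
proof (rule ccontr)
  assume "a \<notin> Units R"
  then obtain p y where p: "p \<in> primes" "y \<in> carrier R" "a = emb p \<otimes> y"
    using nonunit_prime assms(1) by blast
  have "a \<otimes> x = \<zero>" if "x \<in> socle p" for x
  proof -
    have "a \<otimes> x = y \<otimes> (emb p \<otimes> x)" unfolding p(3) using socle_carrier[OF that] p(2) by (simp add: m_ac)
    then show ?thesis using socle_emb[OF that] p(2) by simp
  qed
  then show False using assms(2)[OF p(1)] by blast
qed

text \<open>By \<open>socle_mult_imp\<close> every socle consists of multiples of such an
  \<open>n\<close>; hence the way a unit moves \<open>n\<close> determines how it moves the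
  socles.\<close>

definition tame :: "'a \<Rightarrow> bool" where
  "tame n \<longleftrightarrow> n \<in> carrier R \<and> (\<forall>p\<in>primes. idem p \<otimes> n \<noteq> \<zero>)"

lemma tame_carrier: "tame n \<Longrightarrow> n \<in> carrier R"
  by (simp add: tame_def)

lemma tame_factor: "tame (a \<otimes> b) \<Longrightarrow> a \<in> carrier R \<Longrightarrow> b \<in> carrier R \<Longrightarrow> tame a"
  by (auto simp: tame_def simp flip: m_assoc)

lemma tame_mult_unit: "tame n \<Longrightarrow> u \<in> Units R \<Longrightarrow> tame (n \<otimes> u)"
  using tame_factor[of "n \<otimes> u" "inv u"] tame_carrier[of n] m_assoc[of n u "inv u"] Units_closed[of u]
  by simp

lemma tame_one: "tame \<one>"
proof -
  have "idem p \<noteq> \<zero>" if "p \<in> primes" for p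
  proof
    assume "idem p = \<zero>"
    moreover obtain x where "x \<in> socle p" "x \<noteq> \<zero>" by (rule socle_nontrivial[OF \<open>p \<in> primes\<close>])
    ultimately show False using idem_socle[OF that] by force
  qed
  then show ?thesis by (simp add: tame_def)
qed

section \<open>Groups of units acting on translates of the socles\<close>

definition unit_group :: "'a set \<Rightarrow> bool" where
  "unit_group J \<longleftrightarrow> J \<subseteq> Units R \<and> \<one> \<in> J \<and> (\<forall>x\<in>J. \<forall>y\<in>J. x \<otimes> y \<in> J) \<and> (\<forall>x\<in>J. inv x \<in> J)"

lemma unit_groupD:
  assumes "unit_group J"
  shows "x \<in> J \<Longrightarrow> x \<in> Units R" "x \<in> J \<Longrightarrow> x \<in> carrier R" "\<one> \<in> J"
    "x \<in> J \<Longrightarrow> y \<in> J \<Longrightarrow> x \<otimes> y \<in> J" "x \<in> J \<Longrightarrow> inv x \<in> J"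
  using assms by (auto simp: unit_group_def)

lemma unit_group_pow: "unit_group J \<Longrightarrow> u \<in> J \<Longrightarrow> u [^] (k::nat) \<in> J"
  by (induction k) (auto dest: unit_groupD)

lemma mult_shift:
  assumes "n \<otimes> u = n \<oplus> t" "n \<in> carrier R" "u \<in> carrier R" "t \<in> carrier R" "c \<in> carrier R"
  shows "c \<otimes> n \<otimes> u = c \<otimes> n \<oplus> c \<otimes> t"
  using assms by (simp add: m_assoc r_distr)

text \<open>Write \<open>u\<close> as \<one> plus \<open>d\<close>. Multiplication by
  \<open>d\<close> sends \<open>x\<close> to \<open>t\<close>, \<open>t\<close> to \<open>t'\<close>
  and \<open>t'\<close> to \<zero>, so the binomial expansion stops after the quadratic
  term.\<close>

lemma unipotent_pow:
  assumes "x \<otimes> u = x \<oplus> t" "t \<otimes> u = t \<oplus> t'" "t' \<otimes> u = t'"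
    and [simp]: "x \<in> carrier R" "u \<in> carrier R" "t \<in> carrier R" "t' \<in> carrier R"
  shows "x \<otimes> u [^] (k::nat) = x \<oplus> emb k \<otimes> t \<oplus> emb (k choose 2) \<otimes> t'"
proof (induction k)
  case 0
  then show ?case by (simp add: numeral_2_eq_2)
next
  case (Suc k)
  have c: "Suc k choose 2 = (k choose 2) + k" by (simp add: numeral_2_eq_2)
  have e: "emb (Suc k) = emb k \<oplus> \<one>" using emb_add[of k 1] by simp
  have "x \<otimes> u [^] Suc k = (x \<otimes> u [^] k) \<otimes> u" by (simp add: m_assoc)
  also have "\<dots> = x \<otimes> u \<oplus> emb k \<otimes> (t \<otimes> u) \<oplus> emb (k choose 2) \<otimes> (t' \<otimes> u)"
    unfolding Suc by (simp add: l_distr m_assoc)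
  also have "\<dots> = x \<oplus> emb (Suc k) \<otimes> t \<oplus> emb (Suc k choose 2) \<otimes> t'"
    unfolding assms(1-3) c e emb_add by (simp add: l_distr r_distr a_ac)
  finally show ?case .
qed

lemma unipotent_pow':
  assumes "x \<otimes> u = x \<oplus> t" "t \<otimes> u = t" "x \<in> carrier R" "u \<in> carrier R" "t \<in> carrier R"
  shows "x \<otimes> u [^] (k::nat) = x \<oplus> emb k \<otimes> t"
  using unipotent_pow[of x u t \<zero> k] assms by simp

lemma add_cancel_zero: "a = a \<oplus> b \<Longrightarrow> a \<in> carrier R \<Longrightarrow> b \<in> carrier R \<Longrightarrow> b = \<zero>"
  using add.l_cancel[of a b \<zero>] by simp

text \<open>A unit of \<open>J\<close> that moves \<open>emb q \<otimes> n1\<close> by a chosen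
  socle element moves \<open>n1\<close> by a known amount up to an error \<open>s\<close> killed by
  \<open>q\<close>. A power of that unit removes the error: exponent \<open>idem_index p\<close> if
  \<open>q \<noteq> p\<close>, exponent \<open>p\<close> if \<open>q = p\<close>.\<close>

lemma socle_coset_descend:
  assumes q: "q \<in> primes" and p: "p \<in> primes" and J: "unit_group J"
    and n1: "n1 \<in> carrier R" and tm: "tame (emb q \<otimes> n1)"
    and cov: "\<And>h. h \<in> socle p \<Longrightarrow> emb q \<otimes> n1 \<oplus> h \<in> (\<otimes>) (emb q \<otimes> n1) ` J"
    and h: "h \<in> socle p"
  shows "n1 \<oplus> h \<in> (\<otimes>) n1 ` J"
proof -
  define n where "n = emb q \<otimes> n1"
  have n: "n \<in> carrier R" using n1 by (simp add: n_def)
  have hc: "h \<in> carrier R" using h by blast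
  have tame_n: "idem r \<otimes> n \<noteq> \<zero>" if "r \<in> primes" for r
    using tm that by (simp add: tame_def n_def)
  \<comment> \<open>Otherwise the \<open>p\<close>-component of \<open>n\<close> lies in
    \<open>socle p\<close>, and subtracting it from \<open>n\<close> would stay in the coset of
    \<open>n\<close>, all of whose elements are tame.\<close>
  have good: "idem p \<otimes> (emb p \<otimes> n) \<noteq> \<zero>"
  proof
    assume "idem p \<otimes> (emb p \<otimes> n) = \<zero>"
    then have "emb p \<otimes> (idem p \<otimes> n) = \<zero>" using n by (simp add: m_lcomm)
    then have "\<ominus> (idem p \<otimes> n) \<in> socle p" using n by (intro socle_minus) (simp add: socle_def)
    from cov[OF this] obtain u where u: "u \<in> J" "n \<oplus> \<ominus> (idem p \<otimes> n) = n \<otimes> u"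
      by (auto simp: n_def)
    have "idem p \<otimes> (n \<oplus> \<ominus> (idem p \<otimes> n)) = idem p \<otimes> n \<oplus> \<ominus> (idem p \<otimes> idem p \<otimes> n)"
      using n by (simp add: r_distr r_minus m_assoc)
    also have "\<dots> = \<zero>" unfolding idem_idem[OF p] using n by (simp add: r_neg)
    finally have "idem p \<otimes> (n \<otimes> u) = \<zero>" unfolding u(2) .
    moreover have "tame (n \<otimes> u)"
      using tm unit_groupD(1)[OF J u(1)] unfolding n_def by (rule tame_mult_unit)
    ultimately show False using p by (simp add: tame_def)
  qed
  obtain r where r: "r \<in> carrier R" "h = emb p \<otimes> n \<otimes> r"
    using socle_mult_imp[OF p _ good h] n by auto
  show ?thesis
  proof (cases "q = p")
    case False
    have "emb q \<otimes> h \<in> socle p" using h by auto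
    from cov[OF this] obtain u where u: "u \<in> J" "n \<oplus> emb q \<otimes> h = n \<otimes> u" by (auto simp: n_def)
    note uc [simp] = unit_groupD(2)[OF J u(1)]
    define s where "s = n1 \<otimes> u \<ominus> n1 \<ominus> h"
    have sc: "s \<in> carrier R" using n1 hc by (simp add: s_def)
    have nu: "n1 \<otimes> u = n1 \<oplus> (h \<oplus> s)"
      unfolding s_def using n1 hc by (intro add_diff_diff) simp_all
    have "n \<otimes> u = n \<oplus> emb q \<otimes> (h \<oplus> s)"
      using mult_shift[OF nu, of "emb q"] n1 hc sc by (simp add: n_def)
    then have "n \<oplus> emb q \<otimes> h = (n \<oplus> emb q \<otimes> h) \<oplus> emb q \<otimes> s"
      unfolding u(2)[symmetric] using n hc sc by (simp add: r_distr a_assoc)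
    then have "emb q \<otimes> s = \<zero>" using n hc sc by (intro add_cancel_zero) simp_all
    then have s: "s \<in> socle q" using sc by (simp add: socle_def)
    obtain r' where r': "r' \<in> carrier R" "s = n \<otimes> r'"
      using socle_mult_imp[OF q n tame_n[OF q] s] by blast
    have hs: "emb p \<otimes> (h \<oplus> s) = emb p \<otimes> s" "idem q \<otimes> h = \<zero>" "idem p \<otimes> h = h" "idem p \<otimes> s = \<zero>"
      "idem q \<otimes> s = s"
      using idem_socle_other[OF q p False h] idem_socle[OF p h] idem_socle[OF q s]
        idem_socle_other[OF p q _ s] False hc sc socle_emb[OF h] by (simp_all add: r_distr)
    \<comment> \<open>\<open>h\<close> is a multiple of \<open>n1\<close> by a factor containing
      both \<open>p\<close> and \<open>q\<close>, which kills the displacement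
      \<open>h \<oplus> s\<close>.\<close>
    have hu: "h \<otimes> u = h"
    proof -
      have hn: "h = (emb p \<otimes> emb q \<otimes> r) \<otimes> n1" unfolding r(2) n_def using r(1) n1 by (simp add: m_ac)
      have "(emb p \<otimes> emb q \<otimes> r) \<otimes> (h \<oplus> s) = r \<otimes> (emb q \<otimes> (emb p \<otimes> (h \<oplus> s)))"
        using r(1) hc sc by (simp add: m_ac)
      also have "\<dots> = r \<otimes> (emb p \<otimes> (emb q \<otimes> s))" unfolding hs using sc by (simp add: m_lcomm)
      also have "\<dots> = \<zero>" using r(1) socle_emb[OF s] by simp
      finally show ?thesis using mult_shift[OF nu, of "emb p \<otimes> emb q \<otimes> r"] r(1) n1 hc sc
        by (simp flip: hn)
    qed
    have su: "s \<otimes> u = s"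
    proof -
      have "s = idem q \<otimes> s" by (simp add: hs)
      then have sn: "s = (idem q \<otimes> emb q \<otimes> r') \<otimes> n1" unfolding r'(2) n_def using r'(1) n1 by (simp add: m_ac)
      have "(idem q \<otimes> emb q \<otimes> r') \<otimes> (h \<oplus> s) = r' \<otimes> (emb q \<otimes> (idem q \<otimes> h \<oplus> idem q \<otimes> s))"
        using r'(1) hc sc by (simp add: m_ac r_distr)
      also have "\<dots> = \<zero>" unfolding hs using r'(1) sc socle_emb[OF s] by simp
      finally show ?thesis using mult_shift[OF nu, of "idem q \<otimes> emb q \<otimes> r'"] r'(1) n1 hc sc
        by (simp flip: sn)
    qed
    have "n1 \<otimes> u [^] idem_index p = n1 \<oplus> idem p \<otimes> (h \<oplus> s)"
      unfolding idem_def using hc sc n1 hu su by (intro unipotent_pow' nu) (simp_all add: l_distr)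
    also have "idem p \<otimes> (h \<oplus> s) = h" using hc sc by (simp add: r_distr hs)
    finally show ?thesis using unit_group_pow[OF J u(1)] by (metis image_eqI)
  next
    case True
    note [simp] = True
    from cov[OF h] obtain u where u: "u \<in> J" "n \<oplus> h = n \<otimes> u" by (auto simp: n_def)
    note uc [simp] = unit_groupD(2)[OF J u(1)]
    \<comment> \<open>A solution of \<open>emb p \<otimes> g = h\<close>: the displacement expected
      at \<open>n1\<close>, since the one at \<open>emb p \<otimes> n1\<close> is
      \<open>h\<close>.\<close>
    define g where "g = n \<otimes> r"
    have gc: "g \<in> carrier R" using n r by (simp add: g_def)
    have pg: "emb p \<otimes> g = h" unfolding g_def r(2) using n r(1) by (simp add: m_assoc)
    define s where "s = n1 \<otimes> u \<ominus> n1 \<ominus> g"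
    have sc: "s \<in> carrier R" using n1 gc by (simp add: s_def)
    have nu: "n1 \<otimes> u = n1 \<oplus> (g \<oplus> s)"
      unfolding s_def using n1 gc by (intro add_diff_diff) simp_all
    have "n \<otimes> u = n \<oplus> emb p \<otimes> (g \<oplus> s)"
      using mult_shift[OF nu, of "emb p"] n1 gc sc by (simp add: n_def)
    then have "n \<oplus> h = (n \<oplus> h) \<oplus> emb p \<otimes> s"
      unfolding u(2)[symmetric] using n gc hc sc by (simp add: r_distr pg a_assoc)
    then have ps: "emb p \<otimes> s = \<zero>" using n hc sc by (intro add_cancel_zero) simp_all
    then have s: "s \<in> socle p" using sc by (simp add: socle_def)
    have pt: "emb p \<otimes> (g \<oplus> s) = h" using gc sc hc by (simp add: r_distr pg ps)
    obtain r' where r': "r' \<in> carrier R" "s = emb p \<otimes> n \<otimes> r'"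
      using socle_mult_imp[OF p _ good s] n by auto
    have gu: "g \<otimes> u = g \<oplus> r \<otimes> h"
    proof -
      have gn: "g = (emb p \<otimes> r) \<otimes> n1" unfolding g_def n_def using r(1) n1 by (simp add: m_ac)
      have "(emb p \<otimes> r) \<otimes> (g \<oplus> s) = r \<otimes> (emb p \<otimes> (g \<oplus> s))"
        using r(1) gc sc by (simp add: m_ac)
      also have "\<dots> = r \<otimes> h" by (simp only: pt)
      finally show ?thesis using mult_shift[OF nu, of "emb p \<otimes> r"] r(1) n1 gc sc by (simp flip: gn)
    qed
    have su: "s \<otimes> u = s"
    proof -
      have sn: "s = (emb p \<otimes> emb p \<otimes> r') \<otimes> n1" unfolding r'(2) n_def using r'(1) n1 by (simp add: m_ac)
      have "(emb p \<otimes> emb p \<otimes> r') \<otimes> (g \<oplus> s) = r' \<otimes> (emb p \<otimes> (emb p \<otimes> (g \<oplus> s)))"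
        using r'(1) gc sc by (simp add: m_ac)
      also have "\<dots> = \<zero>" unfolding pt socle_emb[OF h] using r'(1) by simp
      finally show ?thesis using mult_shift[OF nu, of "emb p \<otimes> emb p \<otimes> r'"] r'(1) n1 gc sc
        by (simp flip: sn)
    qed
    have hu: "(r \<otimes> h) \<otimes> u = r \<otimes> h"
    proof -
      have hn: "r \<otimes> h = (emb p \<otimes> emb p \<otimes> r \<otimes> r) \<otimes> n1"
        unfolding r(2) n_def using r(1) n1 by (simp add: m_ac)
      have "(emb p \<otimes> emb p \<otimes> r \<otimes> r) \<otimes> (g \<oplus> s) = r \<otimes> (r \<otimes> (emb p \<otimes> (emb p \<otimes> (g \<oplus> s))))"
        using r(1) gc sc by (simp add: m_ac)
      also have "\<dots> = \<zero>" unfolding pt socle_emb[OF h] using r(1) by simp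
      finally show ?thesis using mult_shift[OF nu, of "emb p \<otimes> emb p \<otimes> r \<otimes> r"] r(1) n1 gc sc hc
        by (simp flip: hn)
    qed
    have tu: "(g \<oplus> s) \<otimes> u = (g \<oplus> s) \<oplus> r \<otimes> h"
      using gc sc hc r(1) by (simp add: l_distr gu su a_ac)
    have "n1 \<otimes> u [^] p = n1 \<oplus> emb p \<otimes> (g \<oplus> s) \<oplus> emb (p choose 2) \<otimes> (r \<otimes> h)"
      by (rule unipotent_pow[OF nu tu hu]) (use n1 gc sc hc r(1) in simp_all)
    \<comment> \<open>The unit moves \<open>g\<close> by \<open>r \<otimes> h\<close>, which creates
      the quadratic term; for odd \<open>p\<close> its coefficient kills this socle element.\<close>
    moreover have "p dvd p choose 2"
    proof -
      obtain b where b: "p = 2 * b + 1" using odd_primes[OF p] by (rule oddE)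
      then have "p choose 2 = p * b" by (simp add: choose_two)
      then show ?thesis by simp
    qed
    moreover have "r \<otimes> h \<in> socle p" using h r(1) by auto
    ultimately have "n1 \<otimes> u [^] p = n1 \<oplus> h"
      using n1 hc by (simp add: socle_emb_dvd pt)
    then show ?thesis using unit_group_pow[OF J u(1), of p] by (metis image_eqI)
  qed
qed

text \<open>Induction on the size of the annihilator of \<open>n\<close>. At a unit, purity at
  \<one> is multiplied by \<open>n\<close>. A non-unit is \<open>emb q \<otimes> n1\<close>, where
  \<open>n1\<close> has a smaller annihilator, and \<open>socle_coset_descend\<close> would carry a
  covered translate of the socle down to \<open>n1\<close>.\<close>

lemma tame_no_socle_coset:
  assumes J: "unit_group J" and pure: "\<And>p. p \<in> primes \<Longrightarrow> \<exists>h\<in>socle p. \<one> \<oplus> h \<notin> J"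
    and n: "tame n" and p: "p \<in> primes"
  shows "\<exists>h\<in>socle p. n \<oplus> h \<notin> (\<otimes>) n ` J"
  using n
proof (induction "card {x \<in> carrier R. n \<otimes> x = \<zero>}" arbitrary: n rule: less_induct)
  case less
  note nc = tame_carrier[OF less.prems]
  show ?case
  proof (cases "n \<in> Units R")
    case True
    obtain h where h: "h \<in> socle p" "\<one> \<oplus> h \<notin> J" using pure[OF p] by blast
    note hc = socle_carrier[OF h(1)]
    have "n \<oplus> n \<otimes> h \<notin> (\<otimes>) n ` J"
    proof
      assume "n \<oplus> n \<otimes> h \<in> (\<otimes>) n ` J"
      then obtain u where u: "u \<in> J" "n \<oplus> n \<otimes> h = n \<otimes> u" by blast
      have "n \<otimes> (\<one> \<oplus> h) = n \<otimes> u" using u(2) nc hc by (simp add: r_distr)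
      then have "\<one> \<oplus> h = u" using Units_l_cancel[OF True, of "\<one> \<oplus> h" u] hc unit_groupD(2)[OF J u(1)] by simp
      with u(1) h(2) show False by simp
    qed
    moreover have "n \<otimes> h \<in> socle p" using h nc by auto
    ultimately show ?thesis by blast
  next
    case False
    then obtain q n1 where q: "q \<in> primes" and n1: "n1 \<in> carrier R" and nq: "n = emb q \<otimes> n1"
      using nonunit_prime nc by metis
    have t1: "tame n1"
      by (rule tame_factor[of n1 "emb q"]) (use less.prems n1 in \<open>simp_all add: nq m_comm\<close>)
    then have "idem q \<otimes> n1 \<noteq> \<zero>" using q by (simp add: tame_def)
    \<comment> \<open>For strictness: \<open>r\<close> takes \<open>n1\<close> to a non-zero element
      of \<open>socle q\<close>, which the extra factor \<open>emb q\<close> kills.\<close>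
    obtain y where y: "y \<in> socle q" "y \<noteq> \<zero>" by (rule socle_nontrivial[OF q])
    obtain r where r: "r \<in> carrier R" "y = n1 \<otimes> r"
      using socle_mult_imp[OF q n1 \<open>idem q \<otimes> n1 \<noteq> \<zero>\<close> y(1)] by blast
    have "r \<in> {x \<in> carrier R. n \<otimes> x = \<zero>}"
      using r n1 socle_emb[OF y(1)] by (simp add: nq m_assoc)
    moreover have "r \<notin> {x \<in> carrier R. n1 \<otimes> x = \<zero>}" using r y by simp
    moreover have "{x \<in> carrier R. n1 \<otimes> x = \<zero>} \<subseteq> {x \<in> carrier R. n \<otimes> x = \<zero>}"
      using n1 by (auto simp: nq m_assoc)
    ultimately have "card {x \<in> carrier R. n1 \<otimes> x = \<zero>} < card {x \<in> carrier R. n \<otimes> x = \<zero>}"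
      by (intro psubset_card_mono) (auto simp: finite_carrier)
    then have "\<exists>h\<in>socle p. n1 \<oplus> h \<notin> (\<otimes>) n1 ` J" using less.hyps t1 by blast
    then show ?thesis
      using socle_coset_descend[OF q p J n1] less.prems unfolding nq by blast
  qed
qed

text \<open>Among the displacements in \<open>G\<close>, those leading from \<open>n\<close> back
  into its own coset form the group \<open>W\<close>, and those leading into the coset of
  \<open>m\<close> lie in one coset \<open>v + W\<close> that misses \<zero>. As \<open>W\<close> is
  stable under the idempotents, each \<open>t p\<close> can be chosen separately: outside
  \<open>W\<close>, and outside \<open>idem p \<otimes> v + W\<close> whenever
  \<open>idem p \<otimes> v\<close> is not in \<open>W\<close>.\<close>

lemma coset_avoid:
  assumes n: "tame n" and m: "tame m" and J: "unit_group J" and nm: "n \<notin> (\<otimes>) m ` J"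
    and noncov: "\<And>p. p \<in> primes \<Longrightarrow> \<exists>h\<in>socle p. n \<oplus> h \<notin> (\<otimes>) n ` J"
  obtains t where "\<And>p. p \<in> primes \<Longrightarrow> t p \<in> socle p \<and> t p \<noteq> \<zero>"
    "\<And>s. s \<in> carrier R \<Longrightarrow> s \<noteq> \<zero> \<Longrightarrow> (\<And>p. p \<in> primes \<Longrightarrow> idem p \<otimes> s = \<zero> \<or> idem p \<otimes> s = t p) \<Longrightarrow>
       n \<oplus> s \<notin> (\<otimes>) n ` J \<and> n \<oplus> s \<notin> (\<otimes>) m ` J"
proof -
  note nc [simp] = tame_carrier[OF n] and mc [simp] = tame_carrier[OF m]
  note Jc = unit_groupD(2)[OF J]
  (* At a bad prime p the component of n lies in socle p and t p cancels it.  At the other primes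
     every element of J moving n by an element of G fixes G pointwise, which makes W a subgroup. *)
  define bad where "bad p \<longleftrightarrow> idem p \<otimes> (emb p \<otimes> n) = \<zero>" for p
  define G where "G = {s \<in> carrier R. \<forall>p\<in>primes. idem p \<otimes> s \<in> socle p \<and> (bad p \<longrightarrow> idem p \<otimes> s = \<zero>)}"
  define W where "W = {s \<in> G. n \<oplus> s \<in> (\<otimes>) n ` J}"
  have Gc: "s \<in> carrier R" if "s \<in> G" for s using that by (simp add: G_def)
  have G_socle: "idem p \<otimes> s \<in> socle p" if "s \<in> G" "p \<in> primes" for s p using that by (simp add: G_def)
  have G_add: "s \<oplus> s' \<in> G" if "s \<in> G" "s' \<in> G" for s s'
    using that by (auto simp: G_def r_distr)
  have G_minus: "\<ominus> s \<in> G" if "s \<in> G" for s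
    using that by (auto simp: G_def r_minus)
  have G_mult: "s \<otimes> x \<in> G" if "s \<in> G" "x \<in> carrier R" for s x
    using that by (auto simp: G_def simp flip: m_assoc)
  have G_socleI: "h \<in> G" if "h \<in> socle p" "p \<in> primes" "\<not> bad p" for h p
    using that idem_socle[OF that(2,1)] idem_socle_other[OF _ that(2) _ that(1)] socle_carrier[OF that(1)]
    unfolding G_def by (smt (verit, ccfv_threshold) mem_Collect_eq socle_zero)
  \<comment> \<open>At a prime that is not bad, the component of \<open>s\<close> is a multiple of
    \<open>emb p \<otimes> n\<close>, and \<open>emb p\<close> kills the component of the
    displacement \<open>v\<close>.\<close>
  have G_fix: "s \<otimes> j = s" if s: "s \<in> G" and j: "j \<in> carrier R" and v: "v \<in> G" and e: "n \<otimes> j = n \<oplus> v" for s j v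
  proof (rule idem_ext)
    fix p assume p: "p \<in> primes"
    show "idem p \<otimes> (s \<otimes> j) = idem p \<otimes> s"
    proof (cases "bad p")
      case True
      then have "idem p \<otimes> s = \<zero>" using s p by (simp add: G_def)
      then show ?thesis using m_assoc[of "idem p" s j] Gc[OF s] j by simp
    next
      case False
      obtain r where r: "r \<in> carrier R" "idem p \<otimes> s = emb p \<otimes> n \<otimes> r"
        using socle_mult_imp[OF p _ _ G_socle[OF s p], of "emb p \<otimes> n"] False by (auto simp: bad_def)
      have "idem p \<otimes> s = idem p \<otimes> (idem p \<otimes> s)"
        using idem_socle[OF p G_socle[OF s p]] by simp
      then have sn: "idem p \<otimes> s = (emb p \<otimes> r \<otimes> idem p) \<otimes> n" unfolding r(2) using r(1) by (simp add: m_ac)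
      have "(emb p \<otimes> r \<otimes> idem p) \<otimes> v = r \<otimes> (emb p \<otimes> (idem p \<otimes> v))"
        using r(1) Gc[OF v] by (simp add: m_ac)
      also have "\<dots> = \<zero>" using r(1) socle_emb[OF G_socle[OF v p]] by simp
      finally have "(emb p \<otimes> r \<otimes> idem p) \<otimes> n \<otimes> j = (emb p \<otimes> r \<otimes> idem p) \<otimes> n"
        using mult_shift[OF e, of "emb p \<otimes> r \<otimes> idem p"] r(1) j Gc[OF v] by simp
      then show ?thesis unfolding sn[symmetric] using j Gc[OF s] by (simp add: m_assoc)
    qed
  qed (use j Gc[OF s] in simp_all)
  have WD: "\<exists>j\<in>J. n \<otimes> j = n \<oplus> s \<and> (\<forall>s'\<in>G. s' \<otimes> j = s')" if s: "s \<in> W" for s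
  proof -
    obtain j where j: "j \<in> J" "n \<oplus> s = n \<otimes> j" and "s \<in> G" using s by (auto simp: W_def)
    then show ?thesis using G_fix[OF _ Jc[OF j(1)] \<open>s \<in> G\<close>] by metis
  qed
  have WG: "s \<in> G" if "s \<in> W" for s using that by (simp add: W_def)
  have WI: "s \<in> W" if "s \<in> G" "n \<otimes> j = n \<oplus> s" "j \<in> J" for s j
    unfolding W_def using that by (metis (mono_tags, lifting) image_eqI mem_Collect_eq)
  have W_zero: "\<zero> \<in> W"
    by (rule WI[of _ \<one>]) (auto simp: G_def unit_groupD(3)[OF J])
  have W_add: "s \<oplus> s' \<in> W" if s: "s \<in> W" and s': "s' \<in> W" for s s'
  proof -
    obtain j where j: "j \<in> J" "n \<otimes> j = n \<oplus> s" using WD[OF s] by blast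
    obtain j' where j': "j' \<in> J" "n \<otimes> j' = n \<oplus> s'" "s \<otimes> j' = s" using WD[OF s'] WG[OF s] by blast
    have "n \<otimes> (j \<otimes> j') = n \<otimes> j \<otimes> j'"
      by (rule m_assoc[OF nc Jc[OF j(1)] Jc[OF j'(1)], symmetric])
    also have "\<dots> = n \<oplus> (s \<oplus> s')" unfolding j(2)
      using Jc[OF j'(1)] Gc[OF WG[OF s]] Gc[OF WG[OF s']] by (simp add: l_distr j'(2,3) a_ac)
    finally show ?thesis
      using G_add[OF WG[OF s] WG[OF s']] unit_groupD(4)[OF J j(1) j'(1)] by (intro WI) auto
  qed
  have W_minus: "\<ominus> s \<in> W" if s: "s \<in> W" for s
  proof -
    note sc = Gc[OF WG[OF s]]
    obtain j where j: "j \<in> J" "n \<otimes> j = n \<oplus> s" "s \<otimes> j = s" using WD[OF s] WG[OF s] by blast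
    note ju = unit_groupD(1)[OF J j(1)]
    have "(n \<oplus> \<ominus> s) \<otimes> j = n" using j sc Jc[OF j(1)] by (simp add: l_distr l_minus a_assoc r_neg)
    then have "n \<otimes> inv j = (n \<oplus> \<ominus> s) \<otimes> j \<otimes> inv j" by simp
    also have "\<dots> = n \<oplus> \<ominus> s" using ju sc by (simp add: m_assoc Units_closed)
    finally show ?thesis
      using G_minus[OF WG[OF s]] unit_groupD(5)[OF J j(1)] by (intro WI) auto
  qed
  have W_diff: "s \<ominus> s' \<in> W" if "s \<in> W" "s' \<in> W" for s s'
    unfolding a_minus_def using that by (intro W_add W_minus)
  \<comment> \<open>As \<open>j\<close> fixes \<open>s\<close>, its powers move \<open>n\<close> by
    integer multiples of \<open>s\<close>, and \<open>idem p\<close> is an integer.\<close>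
  have W_idem: "idem p \<otimes> s \<in> W" if s: "s \<in> W" for s p
  proof -
    note sc = Gc[OF WG[OF s]]
    obtain j where j: "j \<in> J" "n \<otimes> j = n \<oplus> s" "s \<otimes> j = s" using WD[OF s] WG[OF s] by blast
    have "n \<otimes> j [^] idem_index p = n \<oplus> idem p \<otimes> s"
      unfolding idem_def by (rule unipotent_pow'[OF j(2,3)]) (use sc Jc j in auto)
    moreover have "idem p \<otimes> s \<in> G" using G_mult[OF WG[OF s], of "idem p"] sc by (simp add: m_comm)
    ultimately show ?thesis using unit_group_pow[OF J j(1)] by (intro WI) auto
  qed
  \<comment> \<open>The quotient \<open>j\<close> of the two units takes \<open>n \<oplus> v\<close>
    to \<open>n \<oplus> s\<close>. It moves \<open>n\<close> by an element of \<open>G\<close>,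
    hence fixes \<open>v\<close>, so it moves \<open>n\<close> by exactly
    \<open>s \<ominus> v\<close>.\<close>
  have V_diff: "s \<ominus> v \<in> W" if s: "s \<in> G" "n \<oplus> s \<in> (\<otimes>) m ` J" and v: "v \<in> G" "n \<oplus> v \<in> (\<otimes>) m ` J" for s v
  proof -
    note sc = Gc[OF s(1)] and vc = Gc[OF v(1)]
    obtain i where i: "i \<in> J" "n \<oplus> s = m \<otimes> i" using s by blast
    obtain k where k: "k \<in> J" "n \<oplus> v = m \<otimes> k" using v by blast
    define j where "j = inv k \<otimes> i"
    have j: "j \<in> J" using i k unit_groupD[OF J] by (simp add: j_def)
    note [simp] = Jc[OF j] Jc[OF i(1)] Jc[OF k(1)]
    note ku = unit_groupD(1)[OF J k(1)]
    have "k \<otimes> j = i"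
      unfolding j_def using ku m_assoc[of k "inv k" i] by simp
    then have eq: "(n \<oplus> v) \<otimes> j = n \<oplus> s" unfolding k(2) i(2) by (simp add: m_assoc)
    then have "n \<otimes> j = n \<oplus> (s \<ominus> v \<otimes> j)"
      using sc vc add_diff_diff[of "n \<otimes> j" n "s \<ominus> v \<otimes> j"]
      by (simp add: l_distr a_minus_def) (metis Jc[OF j] a_assoc a_inv_closed add.inv_solve_right add.m_closed m_closed nc)
    moreover have "s \<ominus> v \<otimes> j \<in> G"
      unfolding a_minus_def using s v by (intro G_add G_minus G_mult) simp_all
    ultimately have "v \<otimes> j = v" and nj: "n \<otimes> j = n \<oplus> (s \<ominus> v \<otimes> j)" using G_fix v(1) Jc[OF j] by blast+
    then have "n \<otimes> j = n \<oplus> (s \<ominus> v)" by simp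
    moreover have "s \<ominus> v \<in> G" unfolding a_minus_def using s v by (intro G_add G_minus)
    ultimately show ?thesis using j by (intro WI) auto
  qed
  have W_ext: "s \<in> W" if s: "s \<in> G" "\<And>p. p \<in> primes \<Longrightarrow> idem p \<otimes> s \<in> W" for s
  proof -
    have "s \<in> W" if "finite P" "P \<subseteq> primes" "s \<in> G" "\<And>p. p \<in> P \<Longrightarrow> idem p \<otimes> s \<in> W"
      "\<And>p. p \<in> primes - P \<Longrightarrow> idem p \<otimes> s = \<zero>" for P s
      using that
    proof (induction P arbitrary: s rule: finite_induct)
      case empty
      have "s = \<zero>" by (rule idem_ext[OF Gc[OF empty(2)] zero_closed]) (use empty(4) in simp)
      then show ?case using W_zero by simp
    next
      case (insert p P)
      have p: "p \<in> primes" using insert by simp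
      have sc: "s \<in> carrier R" using Gc insert by blast
      have eG: "idem p \<otimes> s \<in> G" using insert.prems(3) WG by blast
      have pq: "idem q \<otimes> (s \<ominus> idem p \<otimes> s) = (if q = p then \<zero> else idem q \<otimes> s)" if "q \<in> primes" for q
      proof -
        have "idem q \<otimes> (s \<ominus> idem p \<otimes> s) = idem q \<otimes> s \<ominus> (idem q \<otimes> idem p) \<otimes> s"
          using sc by (simp add: a_minus_def r_distr r_minus m_assoc)
        then show ?thesis using sc idem_orthogonal[OF that p] idem_idem[OF p] by (auto simp: a_minus_def r_neg)
      qed
      have "s \<ominus> idem p \<otimes> s \<in> W"
      proof (rule insert.IH)
        show "P \<subseteq> primes" using insert.prems by simp
        show "s \<ominus> idem p \<otimes> s \<in> G"
          unfolding a_minus_def using insert.prems eG by (intro G_add G_minus)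
        show "idem q \<otimes> (s \<ominus> idem p \<otimes> s) \<in> W" if "q \<in> P" for q
          using that insert.prems insert.hyps by (subst pq) auto
        show "idem q \<otimes> (s \<ominus> idem p \<otimes> s) = \<zero>" if "q \<in> primes - P" for q
          using that insert.prems(4) by (subst pq) auto
      qed
      then have "(s \<ominus> idem p \<otimes> s) \<oplus> idem p \<otimes> s \<in> W"
        using insert.prems(3) by (intro W_add) simp_all
      then show ?case using sc by (simp add: a_minus_def a_assoc l_neg)
    qed
    from this[OF finite_primes subset_refl s] show ?thesis by simp
  qed
  have "\<exists>v\<in>G. v \<notin> W \<and> (\<forall>s\<in>G. n \<oplus> s \<in> (\<otimes>) m ` J \<longrightarrow> s \<ominus> v \<in> W)" if ex: "\<exists>v\<in>G. n \<oplus> v \<in> (\<otimes>) m ` J"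
  proof -
    obtain v where v: "v \<in> G" "n \<oplus> v \<in> (\<otimes>) m ` J" using ex by blast
    have "v \<notin> W"
    proof
      assume "v \<in> W"
      have "\<zero> \<ominus> v \<in> W" using W_diff[OF W_zero \<open>v \<in> W\<close>] .
      obtain i where i: "i \<in> J" "n \<oplus> v = n \<otimes> i" using \<open>v \<in> W\<close> by (auto simp: W_def)
      obtain k where k: "k \<in> J" "n \<oplus> v = m \<otimes> k" using v by blast
      have iu: "i \<in> Units R" and kc: "k \<in> carrier R" using unit_groupD[OF J] i k by auto
      have "n = n \<otimes> i \<otimes> inv i" using iu by (simp add: m_assoc Units_closed)
      also have "\<dots> = m \<otimes> (k \<otimes> inv i)" unfolding i(2)[symmetric] k(2) using iu kc by (simp add: m_assoc)
      finally show False using nm unit_groupD[OF J] i(1) k(1) by (metis image_eqI)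
    qed
    with v V_diff show ?thesis by blast
  qed
  then obtain v where v: "(\<exists>v\<in>G. n \<oplus> v \<in> (\<otimes>) m ` J) \<longrightarrow>
      v \<in> G \<and> v \<notin> W \<and> (\<forall>s\<in>G. n \<oplus> s \<in> (\<otimes>) m ` J \<longrightarrow> s \<ominus> v \<in> W)" by blast
  define t where "t p = (if bad p then \<ominus> (idem p \<otimes> n)
      else SOME h. h \<in> socle p \<and> h \<notin> W \<and> (v \<in> G \<and> idem p \<otimes> v \<notin> W \<longrightarrow> h \<ominus> idem p \<otimes> v \<notin> W))" for p
  have tg: "t p \<in> socle p \<and> t p \<notin> W \<and> (v \<in> G \<and> idem p \<otimes> v \<notin> W \<longrightarrow> t p \<ominus> idem p \<otimes> v \<notin> W)"
    if p: "p \<in> primes" and "\<not> bad p" for p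
  proof -
    obtain h where h: "h \<in> socle p" "n \<oplus> h \<notin> (\<otimes>) n ` J" using noncov[OF p] by blast
    then have hW: "h \<notin> W" by (simp add: W_def)
    note hc = socle_carrier[OF h(1)]
    have "\<exists>h. h \<in> socle p \<and> h \<notin> W \<and> (v \<in> G \<and> idem p \<otimes> v \<notin> W \<longrightarrow> h \<ominus> idem p \<otimes> v \<notin> W)"
    proof (cases "v \<in> G \<and> h \<ominus> idem p \<otimes> v \<in> W")
      case False
      then show ?thesis using h(1) hW by blast
    next
      case True
      then have vc: "v \<in> carrier R" using Gc by blast
      have emb_W: "emb k \<otimes> s \<in> W" if "s \<in> W" for k s
      proof (induction k)
        case (Suc k)
        have "emb (Suc k) \<otimes> s = emb k \<otimes> s \<oplus> s"
          using emb_add[of k 1] Gc[OF WG[OF that]] by (simp add: l_distr)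
        then show ?case using W_add[OF Suc that] by simp
      qed (use W_zero Gc[OF WG[OF that]] in simp)
      \<comment> \<open>If \<open>h\<close> falls into the coset of
        \<open>idem p \<otimes> v\<close>, then \<open>h \<oplus> h\<close> does not, since the two
        differ by \<open>h\<close>. It also stays outside \<open>W\<close>, because 2 is invertible
        modulo \<open>p\<close>.\<close>
      have hh: "h \<oplus> h \<notin> W"
      proof
        assume a: "h \<oplus> h \<in> W"
        obtain k where k: "p = 2 * k + 1" using odd_primes[OF p] by (rule oddE)
        have "emb (k + 1) \<otimes> (h \<oplus> h) = emb ((k + 1) + (k + 1)) \<otimes> h"
          using hc unfolding emb_add[of "k+1" "k+1"] by (simp add: l_distr r_distr)
        also have "(k + 1) + (k + 1) = p + 1" using k by simp
        also have "emb (p + 1) \<otimes> h = h" using hc socle_emb[OF h(1)] emb_add[of p 1] by (simp add: l_distr)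
        finally show False using emb_W[OF a, of "k + 1"] hW by simp
      qed
      moreover have "(h \<oplus> h) \<ominus> idem p \<otimes> v \<notin> W"
      proof
        assume "(h \<oplus> h) \<ominus> idem p \<otimes> v \<in> W"
        from W_diff[OF this conjunct2[OF True]]
        have "((h \<oplus> h) \<ominus> idem p \<otimes> v) \<ominus> (h \<ominus> idem p \<otimes> v) \<in> W" .
        moreover have "(h \<oplus> h) \<ominus> idem p \<otimes> v = h \<oplus> (h \<ominus> idem p \<otimes> v)"
          unfolding a_minus_def using hc vc by (intro a_assoc) simp_all
        moreover have "h \<oplus> w \<ominus> w = h" if "w \<in> carrier R" for w
          unfolding a_minus_def using that hc by (simp add: a_assoc r_neg)
        ultimately have "h \<in> W" using hc vc by simp
        then show False using hW by contradiction
      qed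
      ultimately show ?thesis using h(1) by blast
    qed
    from someI_ex[OF this] show ?thesis using \<open>\<not> bad p\<close> by (simp add: t_def)
  qed
  show thesis
  proof (rule that[of t])
    fix p assume p: "p \<in> primes"
    show "t p \<in> socle p \<and> t p \<noteq> \<zero>"
    proof (cases "bad p")
      case True
      then have "emb p \<otimes> (idem p \<otimes> n) = \<zero>" by (simp add: bad_def m_lcomm)
      then have "idem p \<otimes> n \<in> socle p" by (simp add: socle_def)
      moreover have "idem p \<otimes> n \<noteq> \<zero>" using n p by (simp add: tame_def)
      ultimately show ?thesis using True by (auto simp: t_def)
    next
      case False
      then show ?thesis using tg[OF p] W_zero by metis
    qed
  next
    fix s assume sc: "s \<in> carrier R" and s0: "s \<noteq> \<zero>"
      and st: "\<And>p. p \<in> primes \<Longrightarrow> idem p \<otimes> s = \<zero> \<or> idem p \<otimes> s = t p"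
    show "n \<oplus> s \<notin> (\<otimes>) n ` J \<and> n \<oplus> s \<notin> (\<otimes>) m ` J"
    proof (cases "\<exists>p\<in>primes. bad p \<and> idem p \<otimes> s \<noteq> \<zero>")
      case True
      then obtain p where p: "p \<in> primes" "bad p" "idem p \<otimes> s \<noteq> \<zero>" by blast
      then have "idem p \<otimes> (n \<oplus> s) = idem p \<otimes> n \<oplus> \<ominus> (idem p \<otimes> n)"
        using st[OF p(1)] sc by (simp add: t_def r_distr)
      then have "\<not> tame (n \<oplus> s)" using p(1) by (auto simp: tame_def r_neg)
      then show ?thesis using tame_mult_unit[OF n] tame_mult_unit[OF m] unit_groupD(1)[OF J] by auto
    next
      case False
      have sG: "s \<in> G"
        unfolding G_def using sc False st tg by (smt (verit, best) mem_Collect_eq socle_zero)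
      have "\<exists>p\<in>primes. idem p \<otimes> s \<noteq> \<zero>"
        using idem_ext[OF sc zero_closed] s0 by (metis idem_closed r_null)
      then obtain p where p: "p \<in> primes" "idem p \<otimes> s \<noteq> \<zero>" by blast
      then have "\<not> bad p" "idem p \<otimes> s = t p" using False st by blast+
      then have "s \<notin> W" using tg[OF p(1)] W_idem[of s p] by auto
      then have "n \<oplus> s \<notin> (\<otimes>) n ` J" using sG by (simp add: W_def)
      moreover have "n \<oplus> s \<notin> (\<otimes>) m ` J"
      proof
        assume a: "n \<oplus> s \<in> (\<otimes>) m ` J"
        then have v': "v \<in> G" "v \<notin> W" "s \<ominus> v \<in> W" using v sG by blast+
        note vc = Gc[OF v'(1)]
        \<comment> \<open>A prime where \<open>v\<close> leaves \<open>W\<close>. There the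
          component of \<open>s\<close> is \<zero> or \<open>t q\<close>, and neither differs from
          that of \<open>v\<close> by an element of \<open>W\<close>.\<close>
        obtain q where q: "q \<in> primes" "idem q \<otimes> v \<notin> W" using W_ext v' by blast
        have d: "idem q \<otimes> s \<ominus> idem q \<otimes> v \<in> W"
          using W_idem[OF v'(3), of q] sc vc by (simp add: a_minus_def r_distr r_minus)
        have "\<not> bad q" using q v'(1) W_zero by (auto simp: G_def)
        then have tq: "t q \<ominus> idem q \<otimes> v \<notin> W" using tg[OF q(1)] q v' by blast
        have "\<zero> \<ominus> idem q \<otimes> v \<notin> W"
        proof
          assume "\<zero> \<ominus> idem q \<otimes> v \<in> W"
          then have "\<ominus> (\<zero> \<ominus> idem q \<otimes> v) \<in> W" by (rule W_minus)
          then show False using q(2) vc by (simp add: a_minus_def)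
        qed
        then show False using d tq st[OF q(1)] by auto
      qed
      ultimately show ?thesis ..
    qed
  qed
qed

end

section \<open>Additive characters and the Fourier transform\<close>

lemma complex_nth_root:
  assumes "m > 0" obtains z :: complex where "z ^ m = c"
proof -
  have "rcis (root m (cmod c)) (Arg c / m) ^ m = c"
    using assms by (simp add: DeMoivre2 rcis_cmod_Arg)
  then show thesis by (rule that)
qed

lemma complex_nontrivial_root_unity:
  assumes "m > 1" obtains z :: complex where "z ^ m = 1" "z \<noteq> 1"
proof -
  have "card {z::complex. z ^ m = 1} = m" using assms by (intro card_roots_unity_eq) simp
  then have "\<not> {z::complex. z ^ m = 1} \<subseteq> {1}"
    using assms card_mono[of "{1::complex}" "{z. z ^ m = 1}"] by fastforce
  then show thesis using that by blast
qed

section \<open>Extension of characters of finite abelian groups\<close>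

context comm_group
begin

definition character_on :: "'a set \<Rightarrow> ('a \<Rightarrow> complex) \<Rightarrow> bool" where
  "character_on H \<chi> \<longleftrightarrow> \<chi> \<one> = 1 \<and> (\<forall>x\<in>H. \<forall>y\<in>H. \<chi> (x \<otimes> y) = \<chi> x * \<chi> y)"

lemma finite_subgroupI:
  assumes fin: "finite (carrier G)" and H: "H \<subseteq> carrier G" "\<one> \<in> H" "\<And>x y. x \<in> H \<Longrightarrow> y \<in> H \<Longrightarrow> x \<otimes> y \<in> H"
  shows "subgroup H G"
proof (rule subgroupI)
  fix x assume x: "x \<in> H"
  then have xc: "x \<in> carrier G" using H by blast
  have pow: "x [^] (k::nat) \<in> H" for k by (induction k) (use x H in auto)
  have "order G > 0" using fin one_closed by (auto simp: order_def card_gt_0_iff)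
  then have "x [^] (order G - 1) \<otimes> x = \<one>"
    using pow_order_eq_1[OF xc] nat_pow_Suc[of x "order G - 1"] by simp
  then have "inv x = x [^] (order G - 1)" using xc by (intro inv_equality) auto
  then show "inv x \<in> H" using pow by simp
qed (use H in auto)

lemma subgroup_pow_in: "subgroup H G \<Longrightarrow> x \<in> H \<Longrightarrow> x [^] (k::nat) \<in> H"
  by (induction k) (auto simp: subgroup.one_closed subgroup.m_closed)

lemma character_on_pow:
  "character_on H \<chi> \<Longrightarrow> subgroup H G \<Longrightarrow> x \<in> H \<Longrightarrow> \<chi> (x [^] (k::nat)) = \<chi> x ^ k"
proof (induction k)
  case (Suc k)
  then show ?case
    by (simp add: character_on_def subgroup_pow_in)
qed (simp add: character_on_def)

text \<open>On products of powers of \<open>x\<close> with elements of \<open>H\<close>, send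
  \<open>x [^] k \<otimes> h\<close> to \<open>z ^ k * \<chi> h\<close>. This is well defined
  because \<open>x [^] d\<close> lies in \<open>H\<close> only if \<open>m\<close> divides
  \<open>d\<close>; finiteness makes non-negative exponents suffice.\<close>

lemma character_extend_step:
  assumes fin: "finite (carrier G)" and H: "subgroup H G" and \<chi>: "character_on H \<chi>"
    and x: "x \<in> carrier G" and m: "m > 0" "x [^] m \<in> H" "\<And>r. 0 < r \<Longrightarrow> r < m \<Longrightarrow> x [^] r \<notin> H"
    and z: "z ^ m = \<chi> (x [^] (m::nat))"
  obtains H' \<psi> where "subgroup H' G" "character_on H' \<psi>" "insert x H \<subseteq> H'" "\<And>y. y \<in> H \<Longrightarrow> \<psi> y = \<chi> y" "\<psi> x = z"
proof -
  have Hc: "h \<in> carrier G" if "h \<in> H" for h using subgroup.mem_carrier[OF H that] .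
  have pow_in: "z ^ d = \<chi> (x [^] d)" if d: "x [^] d \<in> H" for d :: nat
  proof -
    have pm: "(x [^] m) [^] (d div m) \<in> H" using subgroup_pow_in[OF H m(2)] .
    have "x [^] d = x [^] (m * (d div m) + d mod m)" by simp
    also have "x [^] (m * (d div m) + d mod m) = (x [^] m) [^] (d div m) \<otimes> x [^] (d mod m)"
      using x by (simp add: nat_pow_mult nat_pow_pow)
    finally have e: "x [^] d = (x [^] m) [^] (d div m) \<otimes> x [^] (d mod m)" .
    have "x [^] (d mod m) = inv ((x [^] m) [^] (d div m)) \<otimes> x [^] d"
      unfolding e using x by (simp flip: m_assoc)
    also have "\<dots> \<in> H" using H pm d by (simp add: subgroup.m_closed subgroup.m_inv_closed)
    finally have "d mod m = 0" using m(3)[of "d mod m"] m(1) by (metis mod_less_divisor neq0_conv)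
    then have d': "d = m * (d div m)" by auto
    then have "x [^] d = (x [^] m) [^] (d div m)" using x by (metis nat_pow_pow)
    then have "\<chi> (x [^] d) = \<chi> (x [^] m) ^ (d div m)" using character_on_pow[OF \<chi> H m(2)] by simp
    also have "\<dots> = z ^ d" unfolding z[symmetric] power_mult[symmetric] using d' by simp
    finally show ?thesis by simp
  qed
  have well: "z ^ k * \<chi> h = z ^ l * \<chi> h'"
    if "x [^] k \<otimes> h = x [^] l \<otimes> h'" "h \<in> H" "h' \<in> H" for k l :: nat and h h'
    using that
  proof (induction k l arbitrary: h h' rule: linorder_wlog)
    case (le k l)
    note [simp] = Hc[OF le(3)] Hc[OF le(4)]
    have "x [^] l = x [^] k \<otimes> x [^] (l - k)" using le(1) x by (simp add: nat_pow_mult)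
    then have "x [^] k \<otimes> h = x [^] k \<otimes> (x [^] (l - k) \<otimes> h')" using le(2) x by (simp add: m_assoc)
    then have h: "h = x [^] (l - k) \<otimes> h'" using x by simp
    then have "x [^] (l - k) = h \<otimes> inv h'" using x by (simp add: m_assoc)
    then have "x [^] (l - k) \<in> H" using H le(3,4) by (simp add: subgroup.m_closed subgroup.m_inv_closed)
    then have "\<chi> h = z ^ (l - k) * \<chi> h'" unfolding h using \<chi> le(4) pow_in by (simp add: character_on_def)
    then show ?case using le(1) by (simp add: mult.assoc[symmetric] power_add[symmetric])
  next
    case (sym k l)
    then show ?case by metis
  qed
  define H' where "H' = {x [^] k \<otimes> h | (k::nat) h. h \<in> H}"
  define \<psi> where "\<psi> y = (SOME c. \<exists>k::nat. \<exists>h\<in>H. y = x [^] k \<otimes> h \<and> c = z ^ k * \<chi> h)" for y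
  have \<psi>: "\<psi> (x [^] k \<otimes> h) = z ^ k * \<chi> h" if "h \<in> H" for k :: nat and h
    unfolding \<psi>_def
  proof (rule some_equality)
    show "\<exists>l::nat. \<exists>h'\<in>H. x [^] k \<otimes> h = x [^] l \<otimes> h' \<and> z ^ k * \<chi> h = z ^ l * \<chi> h'" using that by blast
    fix c assume "\<exists>l::nat. \<exists>h'\<in>H. x [^] k \<otimes> h = x [^] l \<otimes> h' \<and> c = z ^ l * \<chi> h'"
    then show "c = z ^ k * \<chi> h" using well that by metis
  qed
  have HI: "x [^] (k::nat) \<otimes> h \<in> H'" if "h \<in> H" for k h unfolding H'_def using that by blast
  have mm: "(x [^] k \<otimes> h) \<otimes> (x [^] l \<otimes> h') = x [^] (k + l) \<otimes> (h \<otimes> h')" if "h \<in> H" "h' \<in> H" for k l :: nat and h h'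
    using x Hc[OF that(1)] Hc[OF that(2)] by (simp add: m_ac flip: nat_pow_mult)
  have hh: "h \<otimes> h' \<in> H" if "h \<in> H" "h' \<in> H" for h h' using that H by (simp add: subgroup.m_closed)
  have one: "\<one> \<in> H" using H by (rule subgroup.one_closed)
  show thesis
  proof (rule that[of H' \<psi>])
    show "subgroup H' G"
    proof (rule finite_subgroupI[OF fin])
      show "H' \<subseteq> carrier G" unfolding H'_def using x Hc by auto
      show "\<one> \<in> H'" using HI[OF one, of 0] by simp
      show "a \<otimes> b \<in> H'" if "a \<in> H'" "b \<in> H'" for a b
        using that mm hh HI unfolding H'_def by (smt (verit, best) mem_Collect_eq)
    qed
    show "character_on H' \<psi>"
      unfolding character_on_def
    proof (intro conjI ballI)
      show "\<psi> \<one> = 1" using \<psi>[OF one, of 0] \<chi> by (simp add: character_on_def)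
      fix a b assume "a \<in> H'" "b \<in> H'"
      then obtain k h l h' where a: "a = x [^] (k::nat) \<otimes> h" "h \<in> H" and b: "b = x [^] (l::nat) \<otimes> h'" "h' \<in> H"
        unfolding H'_def by blast
      show "\<psi> (a \<otimes> b) = \<psi> a * \<psi> b"
        unfolding a(1) b(1) mm[OF a(2) b(2)] using a b \<chi> hh
        by (simp add: \<psi> power_add character_on_def)
    qed
    show "insert x H \<subseteq> H'"
      using HI[OF one, of 1] HI[of _ 0] x Hc by auto
    show "\<psi> y = \<chi> y" if "y \<in> H" for y using \<psi>[OF that, of 0] Hc[OF that] by simp
    show "\<psi> x = z" using \<psi>[OF one, of 1] x \<chi> by (simp add: character_on_def)
  qed
qed

lemma minimal_pow_in:
  assumes fin: "finite (carrier G)" and H: "subgroup H G" and x: "x \<in> carrier G"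
  obtains m :: nat where "m > 0" "x [^] m \<in> H" "\<And>r. 0 < r \<Longrightarrow> r < m \<Longrightarrow> x [^] r \<notin> H"
proof -
  have "order G > 0" using fin one_closed by (auto simp: order_def card_gt_0_iff)
  then have ex: "order G > 0 \<and> x [^] order G \<in> H"
    using pow_order_eq_1[OF x] subgroup.one_closed[OF H] by simp
  define m where "m = (LEAST m. m > 0 \<and> x [^] (m::nat) \<in> H)"
  have "m > 0 \<and> x [^] m \<in> H" unfolding m_def using ex by (rule LeastI)
  moreover have "x [^] r \<notin> H" if "0 < r" "r < m" for r
    using not_less_Least[of r "\<lambda>m. m > 0 \<and> x [^] (m::nat) \<in> H"] that unfolding m_def by blast
  ultimately show thesis using that by blast
qed

lemma character_extend:
  assumes fin: "finite (carrier G)" and "subgroup H G" "character_on H \<chi>"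
  shows "\<exists>\<psi>. character_on (carrier G) \<psi> \<and> (\<forall>y\<in>H. \<psi> y = \<chi> y)"
  using assms(2,3)
proof (induction "card (carrier G) - card H" arbitrary: H \<chi> rule: less_induct)
  case less
  note Hc = subgroup.subset[OF less.prems(1)]
  show ?case
  proof (cases "H = carrier G")
    case False
    then obtain x where x: "x \<in> carrier G" "x \<notin> H" using Hc by blast
    obtain m :: nat where m: "m > 0" "x [^] m \<in> H" "\<And>r. 0 < r \<Longrightarrow> r < m \<Longrightarrow> x [^] r \<notin> H"
      using minimal_pow_in[OF fin less.prems(1) x(1)] by blast
    obtain z where z: "z ^ m = \<chi> (x [^] m)" using complex_nth_root[OF m(1)] by blast
    obtain H' \<psi> where H': "subgroup H' G" "character_on H' \<psi>" "insert x H \<subseteq> H'" "\<And>y. y \<in> H \<Longrightarrow> \<psi> y = \<chi> y"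
      using character_extend_step[OF fin less.prems x(1) m z] by blast
    have "H' \<subseteq> carrier G" by (rule subgroup.subset[OF H'(1)])
    then have "card H < card H'" "card H' \<le> card (carrier G)"
      using H'(3) x(2) fin by (auto intro!: psubset_card_mono card_mono dest: finite_subset)
    then have "\<exists>\<psi>'. character_on (carrier G) \<psi>' \<and> (\<forall>y\<in>H'. \<psi>' y = \<psi> y)"
      by (intro less.hyps H') simp
    then show ?thesis using H' by (metis insert_subset subsetD)
  qed (use less.prems in blast)
qed

text \<open>The order \<open>m\<close> of \<open>x\<close> exceeds 1, so the trivial character of
  the trivial subgroup extends with an \<open>m\<close>-th root of unity other than 1 as value at
  \<open>x\<close>.\<close>

lemma character_separates:
  assumes fin: "finite (carrier G)" and x: "x \<in> carrier G" "x \<noteq> \<one>"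
  obtains \<psi> where "character_on (carrier G) \<psi>" "\<psi> x \<noteq> 1"
proof -
  have triv: "subgroup {\<one>} G" by (rule triv_subgroup)
  obtain m :: nat where m: "m > 0" "x [^] m \<in> {\<one>}" "\<And>r. 0 < r \<Longrightarrow> r < m \<Longrightarrow> x [^] r \<notin> {\<one>}"
    using minimal_pow_in[OF fin triv x(1)] by blast
  have "m \<noteq> 1" using m(2) x by auto
  then have "m > 1" using m(1) by simp
  then obtain z :: complex where z: "z ^ m = 1" "z \<noteq> 1" by (rule complex_nontrivial_root_unity)
  have c: "character_on {\<one>} (\<lambda>_. 1)" by (simp add: character_on_def)
  obtain H' \<psi> where H': "subgroup H' G" "character_on H' \<psi>" "insert x {\<one>} \<subseteq> H'" "\<psi> x = z"
    using character_extend_step[OF fin triv c x(1) m, of z] z(1) by blast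
  obtain \<psi>' where "character_on (carrier G) \<psi>'" "\<forall>y\<in>H'. \<psi>' y = \<psi> y"
    using character_extend[OF fin H'(1,2)] by blast
  then show thesis using that H' z(2) by auto
qed

end

text \<open>A generating character: every non-zero ideal contains some \<open>socle p\<close>, so
  \<chi> is non-trivial on it, which is what orthogonality requires.\<close>

locale odd_cg_ring_char = odd_cg_ring +
  fixes \<chi> :: "'a \<Rightarrow> complex"
  assumes chi_zero [simp]: "\<chi> \<zero> = 1"
    and chi_add: "\<lbrakk>x \<in> carrier R; y \<in> carrier R\<rbrakk> \<Longrightarrow> \<chi> (x \<oplus> y) = \<chi> x * \<chi> y"
    and chi_socle: "p \<in> primes \<Longrightarrow> \<exists>h\<in>socle p. \<chi> h \<noteq> 1"

text \<open>For each prime take a character that is non-trivial on its socle, compose it with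
  multiplication by \<open>idem p\<close>, and form the product. At an element of one socle all
  other factors are 1.\<close>

lemma (in odd_cg_ring) odd_cg_ring_char_ex:
  obtains \<chi> where "odd_cg_ring_char R \<chi>"
proof -
  have "\<exists>h \<psi>. h \<in> socle p \<and> add.character_on (carrier R) \<psi> \<and> \<psi> h \<noteq> 1" if p: "p \<in> primes" for p
  proof -
    obtain h where h: "h \<in> socle p" "h \<noteq> \<zero>" by (rule socle_nontrivial[OF p])
    then show ?thesis
      using add.character_separates[of h] finite_carrier socle_carrier[OF h(1)] by (metis monoid.simps(2) partial_object.select_convs(1))
  qed
  then obtain h \<psi> where h: "\<And>p. p \<in> primes \<Longrightarrow> h p \<in> socle p \<and> add.character_on (carrier R) (\<psi> p) \<and> \<psi> p (h p) \<noteq> 1"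
    by metis
  have \<psi>: "\<psi> p \<zero> = 1" "x \<in> carrier R \<Longrightarrow> y \<in> carrier R \<Longrightarrow> \<psi> p (x \<oplus> y) = \<psi> p x * \<psi> p y"
    if "p \<in> primes" for p x y
    using h[OF that] by (auto simp: add.character_on_def)
  define \<chi> where "\<chi> x = (\<Prod>p\<in>primes. \<psi> p (idem p \<otimes> x))" for x
  have "odd_cg_ring_char R \<chi>"
  proof (unfold_locales)
    show "\<chi> \<zero> = 1" unfolding \<chi>_def by (intro prod.neutral) (simp add: \<psi>)
    show "\<chi> (x \<oplus> y) = \<chi> x * \<chi> y" if "x \<in> carrier R" "y \<in> carrier R" for x y
      unfolding \<chi>_def prod.distrib[symmetric] using that by (intro prod.cong refl) (simp add: r_distr \<psi>)
    show "\<exists>h\<in>socle p. \<chi> h \<noteq> 1" if p: "p \<in> primes" for p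
    proof (rule bexI)
      have "\<chi> (h p) = (\<Prod>q\<in>primes. if q = p then \<psi> p (h p) else 1)"
        unfolding \<chi>_def using h[OF p] idem_socle[OF p] idem_socle_other[OF _ p]
        by (intro prod.cong refl) (simp add: \<psi>)
      also have "\<dots> = \<psi> p (h p)" using finite_primes p by simp
      finally show "\<chi> (h p) \<noteq> 1" using h[OF p] by simp
      show "h p \<in> socle p" using h[OF p] by simp
    qed
  qed
  then show thesis by (rule that)
qed

section \<open>Fourier inversion and frequencies in the support of a transform\<close>

context odd_cg_ring_char
begin

definition fourier :: "('a \<Rightarrow> complex) \<Rightarrow> 'a \<Rightarrow> complex" where
  "fourier f a = (\<Sum>x\<in>carrier R. f x * \<chi> (a \<otimes> x))"

lemma chi_minus: "x \<in> carrier R \<Longrightarrow> \<chi> x * \<chi> (\<ominus> x) = 1"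
  using chi_add[of x "\<ominus> x"] by (simp add: r_neg)

lemma sum_translate: "r \<in> carrier R \<Longrightarrow> (\<Sum>a\<in>carrier R. F (a \<oplus> r)) = (\<Sum>a\<in>carrier R. F a)"
proof (rule sum.reindex_bij_betw)
  assume r: "r \<in> carrier R"
  show "bij_betw (\<lambda>a. a \<oplus> r) (carrier R) (carrier R)"
    by (rule bij_betwI[of _ _ _ "\<lambda>a. a \<ominus> r"]) (use r in \<open>auto simp: a_minus_def a_assoc l_neg r_neg\<close>)
qed

text \<open>Some \<open>c\<close> satisfies \<open>\<chi> (c \<otimes> x) \<noteq> 1\<close>, and
  translating the summation index by \<open>c\<close> multiplies the sum by this value.\<close>

lemma sum_chi:
  assumes x: "x \<in> carrier R" "x \<noteq> \<zero>"
  shows "(\<Sum>a\<in>carrier R. \<chi> (a \<otimes> x)) = 0"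
proof -
  obtain p r where p: "p \<in> primes" and r: "r \<in> carrier R" and s: "x \<otimes> r \<in> socle p" "x \<otimes> r \<noteq> \<zero>"
    using socle_below[OF x] by metis
  obtain h where h: "h \<in> socle p" "\<chi> h \<noteq> 1" using chi_socle[OF p] by blast
  obtain r' where r': "r' \<in> carrier R" "h = x \<otimes> r \<otimes> r'" using socle_minimal[OF p s h(1)] by blast
  have hx: "h = (r \<otimes> r') \<otimes> x" using r' r x by (simp add: m_ac)
  have "(\<Sum>a\<in>carrier R. \<chi> (a \<otimes> x)) = (\<Sum>a\<in>carrier R. \<chi> ((a \<oplus> r \<otimes> r') \<otimes> x))"
    using sum_translate[of "r \<otimes> r'" "\<lambda>a. \<chi> (a \<otimes> x)"] r r' by simp
  also have "\<dots> = (\<Sum>a\<in>carrier R. \<chi> (a \<otimes> x)) * \<chi> h"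
    unfolding sum_distrib_right using r r' x by (intro sum.cong refl) (simp add: l_distr chi_add hx)
  finally show ?thesis using h(2) by simp
qed

lemma fourier_inversion:
  assumes n: "n \<in> carrier R"
  shows "(\<Sum>a\<in>carrier R. fourier f a * \<chi> (\<ominus> (a \<otimes> n))) = of_nat (order R) * f n"
proof -
  have nn: "n \<ominus> n = \<zero>" using n by simp
  have "(\<Sum>a\<in>carrier R. fourier f a * \<chi> (\<ominus> (a \<otimes> n))) =
      (\<Sum>x\<in>carrier R. \<Sum>a\<in>carrier R. f x * \<chi> (a \<otimes> x) * \<chi> (\<ominus> (a \<otimes> n)))"
    unfolding fourier_def sum_distrib_right by (rule sum.swap)
  also have "\<dots> = (\<Sum>x\<in>carrier R. f x * (\<Sum>a\<in>carrier R. \<chi> (a \<otimes> (x \<ominus> n))))"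
    unfolding sum_distrib_left using n
    by (intro sum.cong refl) (simp add: a_minus_def r_distr chi_add r_minus)
  also have "\<dots> = (\<Sum>x\<in>carrier R. if x = n then of_nat (order R) * f n else 0)"
    using n by (intro sum.cong refl) (simp add: sum_chi order_def nn)
  also have "\<dots> = of_nat (order R) * f n" using n finite_carrier by simp
  finally show ?thesis .
qed

lemma fourier_translate:
  assumes "s \<in> carrier R" "a \<in> carrier R"
  shows "fourier (\<lambda>x. f (x \<oplus> s)) a = \<chi> (\<ominus> (a \<otimes> s)) * fourier f a"
proof -
  have "fourier f a = (\<Sum>x\<in>carrier R. f (x \<oplus> s) * \<chi> (a \<otimes> (x \<oplus> s)))"
    unfolding fourier_def using sum_translate[of s "\<lambda>x. f x * \<chi> (a \<otimes> x)"] assms by simp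
  also have "\<dots> = fourier (\<lambda>x. f (x \<oplus> s)) a * \<chi> (a \<otimes> s)"
    unfolding fourier_def sum_distrib_right using assms
    by (intro sum.cong refl) (simp add: r_distr chi_add)
  finally show ?thesis using chi_minus[of "a \<otimes> s"] assms by (simp add: mult_ac)
qed

lemma fourier_diff: "fourier (\<lambda>x. f x - g x) a = fourier f a - fourier g a"
  by (simp add: fourier_def left_diff_distrib sum_subtractf)

text \<open>Each prime is handled by passing from \<open>f x\<close> to
  \<open>f x - f (x \<oplus> t p)\<close>. The value at \<open>n\<close> survives, as
  \<open>f\<close> vanishes at \<open>n \<oplus> t p\<close>, and the transform is multiplied by
  \<open>1 - \<chi> (\<ominus> (a \<otimes> t p))\<close>. With no primes left, inversion at
  \<open>n\<close> gives a frequency.\<close>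

lemma fourier_support:
  assumes "finite P" "P \<subseteq> primes" and n: "n \<in> carrier R" "f n \<noteq> 0"
    and t: "\<And>p. p \<in> primes \<Longrightarrow> t p \<in> socle p \<and> t p \<noteq> \<zero>"
    and van: "\<And>s. s \<in> carrier R \<Longrightarrow> s \<noteq> \<zero> \<Longrightarrow> (\<And>p. p \<in> P \<Longrightarrow> idem p \<otimes> s = \<zero> \<or> idem p \<otimes> s = t p) \<Longrightarrow>
       (\<And>p. p \<in> primes - P \<Longrightarrow> idem p \<otimes> s = \<zero>) \<Longrightarrow> f (n \<oplus> s) = 0"
  shows "\<exists>a\<in>carrier R. fourier f a \<noteq> 0 \<and> (\<forall>p\<in>P. \<chi> (\<ominus> (a \<otimes> t p)) \<noteq> 1)"
  using assms(1,2) n(2) van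
proof (induction P arbitrary: f rule: finite_induct)
  case empty
  have "\<exists>a\<in>carrier R. fourier f a \<noteq> 0"
  proof (rule ccontr)
    assume "\<not> (\<exists>a\<in>carrier R. fourier f a \<noteq> 0)"
    then have "of_nat (order R) * f n = 0" using fourier_inversion[OF n(1), of f] by simp
    then show False using empty(2) order_pos by simp
  qed
  then show ?case by simp
next
  case (insert p P)
  have p: "p \<in> primes" using insert.prems by simp
  have tp: "t p \<in> carrier R" "t p \<noteq> \<zero>" "idem p \<otimes> t p = t p"
    using t[OF p] idem_socle[OF p] by auto
  have tq: "idem q \<otimes> t p = \<zero>" if "q \<in> primes" "q \<noteq> p" for q
    using idem_socle_other[OF that(1) p that(2)] t[OF p] by blast
  define g where "g x = f x - f (x \<oplus> t p)" for x
  have "\<exists>a\<in>carrier R. fourier g a \<noteq> 0 \<and> (\<forall>q\<in>P. \<chi> (\<ominus> (a \<otimes> t q)) \<noteq> 1)"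
  proof (rule insert.IH)
    show "P \<subseteq> primes" using insert.prems by simp
    have "f (n \<oplus> t p) = 0"
    proof (rule insert.prems(3)[OF tp(1,2)])
      show "idem q \<otimes> t p = \<zero> \<or> idem q \<otimes> t p = t q" if "q \<in> insert p P" for q
        using that tp tq[of q] insert.prems(1) by (cases "q = p") auto
      show "idem q \<otimes> t p = \<zero>" if "q \<in> primes - insert p P" for q
        using that tq[of q] by auto
    qed
    then show "g n \<noteq> 0" using insert.prems(2) by (simp add: g_def)
    fix s assume s: "s \<in> carrier R" "s \<noteq> \<zero>" "\<And>q. q \<in> P \<Longrightarrow> idem q \<otimes> s = \<zero> \<or> idem q \<otimes> s = t q"
      "\<And>q. q \<in> primes - P \<Longrightarrow> idem q \<otimes> s = \<zero>"
    have 1: "f (n \<oplus> s) = 0"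
      using s insert.prems(1) insert.hyps(2) by (intro insert.prems(3)) auto
    have ps: "idem p \<otimes> (s \<oplus> t p) = t p" using s(4)[of p] p insert.hyps(2) s(1) tp by (simp add: r_distr)
    have qs: "idem q \<otimes> (s \<oplus> t p) = idem q \<otimes> s" if "q \<in> primes" "q \<noteq> p" for q
      using that tq s(1) tp by (simp add: r_distr)
    have 2: "f (n \<oplus> (s \<oplus> t p)) = 0"
    proof (rule insert.prems(3))
      show "s \<oplus> t p \<in> carrier R" using s tp by simp
      show "s \<oplus> t p \<noteq> \<zero>" using ps tp by auto
      show "idem q \<otimes> (s \<oplus> t p) = \<zero> \<or> idem q \<otimes> (s \<oplus> t p) = t q" if "q \<in> insert p P" for q
        using that ps qs[of q] s(3)[of q] insert.prems(1) by (cases "q = p") auto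
      show "idem q \<otimes> (s \<oplus> t p) = \<zero>" if "q \<in> primes - insert p P" for q
        using that qs[of q] s(4)[of q] by auto
    qed
    have "n \<oplus> s \<oplus> t p = n \<oplus> (s \<oplus> t p)" using n(1) s(1) tp by (simp add: a_assoc)
    then show "g (n \<oplus> s) = 0" using 1 2 by (simp add: g_def)
  qed
  then obtain a where a: "a \<in> carrier R" "fourier g a \<noteq> 0" "\<forall>q\<in>P. \<chi> (\<ominus> (a \<otimes> t q)) \<noteq> 1" by blast
  have "fourier g a = fourier f a - \<chi> (\<ominus> (a \<otimes> t p)) * fourier f a"
    unfolding g_def fourier_diff using fourier_translate[OF tp(1) a(1)] by simp
  then have "fourier f a \<noteq> 0 \<and> \<chi> (\<ominus> (a \<otimes> t p)) \<noteq> 1" using a(2) by auto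
  then show ?case using a(1,3) by blast
qed

text \<open>Multiplying by the product of the factors \<open>1 - \<chi> (\<ominus> (a \<otimes> t p))\<close> on the Fourier side kills
  every frequency \<open>a\<close> that is not a unit.\<close>

lemma fourier_unit_frequency:
  assumes n: "n \<in> carrier R" "f n \<noteq> 0"
    and t: "\<And>p. p \<in> primes \<Longrightarrow> t p \<in> socle p \<and> t p \<noteq> \<zero>"
    and van: "\<And>s. s \<in> carrier R \<Longrightarrow> s \<noteq> \<zero> \<Longrightarrow> (\<And>p. p \<in> primes \<Longrightarrow> idem p \<otimes> s = \<zero> \<or> idem p \<otimes> s = t p) \<Longrightarrow>
       f (n \<oplus> s) = 0"
  shows "\<exists>w\<in>Units R. fourier f w \<noteq> 0"
proof -
  have "\<exists>a\<in>carrier R. fourier f a \<noteq> 0 \<and> (\<forall>p\<in>primes. \<chi> (\<ominus> (a \<otimes> t p)) \<noteq> 1)"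
  proof (rule fourier_support[where t = t, OF finite_primes subset_refl, where f = f, OF n])
    show "t p \<in> socle p \<and> t p \<noteq> \<zero>" if "p \<in> primes" for p using t that .
    fix s assume "s \<in> carrier R" "s \<noteq> \<zero>" "\<And>p. p \<in> primes \<Longrightarrow> idem p \<otimes> s = \<zero> \<or> idem p \<otimes> s = t p"
    then show "f (n \<oplus> s) = 0" by (rule van)
  qed
  then obtain a where a: "a \<in> carrier R" "fourier f a \<noteq> 0" "\<forall>p\<in>primes. \<chi> (\<ominus> (a \<otimes> t p)) \<noteq> 1"
    by blast
  have "a \<in> Units R"
  proof (rule unit_if_socle[OF a(1)])
    fix p assume p: "p \<in> primes"
    then have "\<chi> (\<ominus> (a \<otimes> t p)) \<noteq> 1" using a(3) by blast
    then have "a \<otimes> t p \<noteq> \<zero>" by (metis chi_zero minus_zero)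
    then show "\<exists>x\<in>socle p. a \<otimes> x \<noteq> \<zero>" using t[OF p] by (intro bexI[of _ "t p"]) simp_all
  qed
  with a show ?thesis by blast
qed

end

section \<open>Dense pure partitions\<close>

text \<open>Multiplication in the S-ring enters as \<open>convS\<close>: the number of
  representations of \<open>z\<close> depends only on the basic set of \<open>z\<close>. It is
  counted in the complex numbers for use with convolution.\<close>

locale dense_partition = odd_cg_ring_char +
  fixes S :: "'a set set"
  assumes partS: "partition_on (carrier R) S"
    and zeroS: "{\<zero>} \<in> S"
    and unitS: "\<lbrakk>A \<in> S; u \<in> Units R\<rbrakk> \<Longrightarrow> (\<otimes>) u ` A \<in> S"
    and convS: "\<lbrakk>A \<in> S; Y \<in> S; Z \<in> S; z \<in> Z; z' \<in> Z\<rbrakk> \<Longrightarrow>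
      (\<Sum>x\<in>A. \<Sum>y\<in>Y. if x \<oplus> y = z then 1 else 0 :: complex) =
      (\<Sum>x\<in>A. \<Sum>y\<in>Y. if x \<oplus> y = z' then 1 else 0)"
    and denseS: "ideal I R \<Longrightarrow> \<exists>T\<subseteq>S. I = \<Union>T"
begin

section \<open>Basic sets, ideals and the group of the identity\<close>

lemma S_subset: "A \<in> S \<Longrightarrow> A \<subseteq> carrier R"
  using partition_onD1[OF partS] by blast

lemma finite_block: "A \<in> S \<Longrightarrow> finite A"
  using S_subset finite_carrier finite_subset by blast

lemma finite_S: "finite S"
  using finite_carrier partS by (rule finite_elements)

definition block :: "'a \<Rightarrow> 'a set" where
  "block x = (THE A. A \<in> S \<and> x \<in> A)"

lemma block_eq: "A \<in> S \<Longrightarrow> x \<in> A \<Longrightarrow> block x = A"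
  unfolding block_def using partition_onD2[OF partS] by (intro the_equality) (auto simp: disjoint_def)

lemma block_mem: "x \<in> carrier R \<Longrightarrow> block x \<in> S" "x \<in> carrier R \<Longrightarrow> x \<in> block x"
  using partition_onD1[OF partS] block_eq by (metis UnionE)+

lemma block_carrier: "x \<in> carrier R \<Longrightarrow> y \<in> block x \<Longrightarrow> y \<in> carrier R"
  using block_mem S_subset by blast

lemma block_cong: "x \<in> carrier R \<Longrightarrow> y \<in> block x \<Longrightarrow> block y = block x"
  using block_mem block_eq by blast

lemma block_ideal: "ideal I R \<Longrightarrow> x \<in> I \<Longrightarrow> block x \<subseteq> I"
  using denseS block_eq by blast

lemma block_unit: "u \<in> Units R \<Longrightarrow> x \<in> carrier R \<Longrightarrow> block (u \<otimes> x) = (\<otimes>) u ` block x"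
  using block_mem by (intro block_eq unitS) auto

text \<open>By density the principal ideal of \<open>y\<close> contains the whole basic set of
  \<open>y\<close>. Consequently the elements of one basic set generate the same ideal, and being a
  unit or being tame passes between them.\<close>

lemma block_dvd:
  assumes "x \<in> carrier R" "y \<in> block x"
  obtains r where "r \<in> carrier R" "x = y \<otimes> r"
proof -
  have y: "y \<in> carrier R" using assms block_carrier by blast
  have "x \<in> block y" using assms block_cong block_mem by blast
  then have "x \<in> PIdl y"
    using block_ideal[OF cgenideal_ideal[OF y] cgenideal_self[OF y]] by blast
  then obtain r where "r \<in> carrier R" "x = r \<otimes> y" unfolding cgenideal_def by blast
  with y that show thesis by (simp add: m_comm)
qed

definition K :: "'a set" where
  "K = block \<one>"

lemma unit_group_K: "unit_group K"
proof -
  have U: "x \<in> Units R" if "x \<in> K" for x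
  proof -
    obtain r where r: "r \<in> carrier R" "\<one> = x \<otimes> r"
      using block_dvd[of \<one> x] \<open>x \<in> K\<close> unfolding K_def by auto
    moreover have "x \<in> carrier R" using block_carrier[of \<one> x] that by (simp add: K_def)
    moreover have "r \<otimes> x = \<one>" using r calculation(3) by (simp add: m_comm)
    ultimately show ?thesis unfolding Units_def by auto
  qed
  have xK: "(\<otimes>) x ` K = K" if "x \<in> K" for x
    using block_unit[OF U[OF that], of \<one>] block_cong[of \<one> x] that Units_closed[OF U[OF that]]
    by (simp add: K_def)
  have one: "\<one> \<in> K" unfolding K_def by (intro block_mem) simp
  have "inv x \<in> K" if x: "x \<in> K" for x
  proof -
    have "\<one> \<in> (\<otimes>) x ` K" using one xK[OF x] by simp
    then obtain k where k: "k \<in> K" "\<one> = x \<otimes> k" by blast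
    then have "inv x = k" using U[OF x] U[OF k(1)] by (metis Units_closed comm_inv_char)
    then show ?thesis using k by simp
  qed
  then show ?thesis unfolding unit_group_def using U xK one by blast
qed

end

locale dense_pure_partition = dense_partition +
  assumes pureS: "p \<in> primes \<Longrightarrow> \<exists>h\<in>socle p. \<one> \<oplus> h \<notin> K"
begin

lemma K_no_socle_coset:
  "tame n \<Longrightarrow> p \<in> primes \<Longrightarrow> \<exists>h\<in>socle p. n \<oplus> h \<notin> (\<otimes>) n ` K"
  by (rule tame_no_socle_coset[OF unit_group_K pureS])

text \<open>Combines \<open>coset_avoid\<close> with \<open>fourier_unit_frequency\<close>. Each use
  takes two cosets whose transforms agree at units and concludes that they coincide. The hypothesis
  \<open>JK\<close> transfers avoidance from \<open>K\<close> to smaller groups.\<close>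

lemma fourier_separates_cosets:
  assumes n: "tame n" and m: "tame m" and J: "unit_group J" and nm: "n \<notin> (\<otimes>) m ` J"
    and JK: "(\<otimes>) n ` J \<subseteq> (\<otimes>) n ` K" and fn: "f n \<noteq> 0"
    and van: "\<And>x. x \<in> carrier R \<Longrightarrow> x \<notin> (\<otimes>) n ` J \<Longrightarrow> x \<notin> (\<otimes>) m ` J \<Longrightarrow> f x = 0"
  shows "\<exists>w\<in>Units R. fourier f w \<noteq> 0"
proof -
  have nonc: "\<exists>h\<in>socle p. n \<oplus> h \<notin> (\<otimes>) n ` J" if "p \<in> primes" for p
    using K_no_socle_coset[OF n that] JK by blast
  obtain t where t: "\<And>p. p \<in> primes \<Longrightarrow> t p \<in> socle p \<and> t p \<noteq> \<zero>"
    and av: "\<And>s. s \<in> carrier R \<Longrightarrow> s \<noteq> \<zero> \<Longrightarrow> (\<And>p. p \<in> primes \<Longrightarrow> idem p \<otimes> s = \<zero> \<or> idem p \<otimes> s = t p) \<Longrightarrow>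
       n \<oplus> s \<notin> (\<otimes>) n ` J \<and> n \<oplus> s \<notin> (\<otimes>) m ` J"
    using coset_avoid[OF n m J nm nonc] by blast
  show ?thesis
  proof (rule fourier_unit_frequency[where f = f and t = t and n = n])
    fix s assume s: "s \<in> carrier R" "s \<noteq> \<zero>" "\<And>p. p \<in> primes \<Longrightarrow> idem p \<otimes> s = \<zero> \<or> idem p \<otimes> s = t p"
    show "f (n \<oplus> s) = 0" using av[OF s] s(1) tame_carrier[OF n] by (intro van) auto
  qed (use tame_carrier[OF n] fn t in simp_all)
qed

section \<open>Character sums of basic sets and the group of equivalent frequencies\<close>

definition hat :: "'a set \<Rightarrow> 'a \<Rightarrow> complex" where
  "hat A a = (\<Sum>x\<in>A. \<chi> (a \<otimes> x))"

lemma fourier_indicator: "A \<subseteq> carrier R \<Longrightarrow> fourier (\<lambda>x. of_bool (x \<in> A)) a = hat A a"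
  unfolding fourier_def hat_def using finite_carrier
  by (simp add: of_bool_def if_distrib[of "\<lambda>t. t * _"] sum.If_cases Int_absorb1 cong: if_cong)

lemma hat_unit:
  assumes "A \<subseteq> carrier R" "u \<in> Units R" "a \<in> carrier R"
  shows "hat ((\<otimes>) u ` A) a = hat A (a \<otimes> u)"
proof -
  have "inj_on ((\<otimes>) u) A" using assms by (intro inj_onI) (metis Units_l_cancel subsetD)
  then show ?thesis
    unfolding hat_def using assms
    by (subst sum.reindex) (auto intro!: sum.cong simp: m_assoc subset_iff)
qed

text \<open>\<open>L\<close> collects the frequencies at which all characteristic sums agree with those at \<open>\<one>\<close>.
  It coincides with \<open>K\<close>: one inclusion uses the Fourier transform of \<open>K\<close>, the other the
  dual description of the indicator of \<open>L\<close> as a Fourier transform.\<close>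

definition L :: "'a set" where
  "L = {a \<in> carrier R. \<forall>A\<in>S. hat A a = hat A \<one>}"

lemma hat_mult_L:
  assumes "b \<in> L" "A \<in> S" "w \<in> Units R"
  shows "hat A (w \<otimes> b) = hat A w"
proof -
  have "hat ((\<otimes>) w ` A) b = hat ((\<otimes>) w ` A) \<one>" using assms unitS by (simp add: L_def)
  then show ?thesis
    using assms hat_unit[OF S_subset[OF assms(2)] assms(3)] Units_closed[OF assms(3)] m_comm[of w b]
    by (simp add: L_def)
qed

text \<open>By density \<open>socle p\<close> is a union of basic sets, so its character sum at
  \<open>a\<close> equals the one at \<one>, which is 0 because \<chi> is non-trivial on it. If
  \<open>a\<close> annihilated \<open>socle p\<close>, the sum at \<open>a\<close> would be the
  cardinality.\<close>

lemma L_subset_Units: "L \<subseteq> Units R"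
proof
  fix a assume a: "a \<in> L"
  show "a \<in> Units R"
  proof (rule unit_if_socle)
    show ac: "a \<in> carrier R" using a by (simp add: L_def)
    fix p assume p: "p \<in> primes"
    show "\<exists>x\<in>socle p. a \<otimes> x \<noteq> \<zero>"
    proof (rule ccontr)
      assume "\<not> (\<exists>x\<in>socle p. a \<otimes> x \<noteq> \<zero>)"
      then have z: "a \<otimes> x = \<zero>" if "x \<in> socle p" for x using that by blast
      obtain h where h: "h \<in> socle p" "\<chi> h \<noteq> 1" using chi_socle[OF p] by blast
      have hc: "h \<in> carrier R" using h by blast
      obtain T where T: "T \<subseteq> S" "socle p = \<Union>T" using denseS[OF socle_ideal] by blast
      have fT: "finite T" using T(1) finite_S finite_subset by blast
      have dis: "\<forall>A\<in>T. \<forall>B\<in>T. A \<noteq> B \<longrightarrow> A \<inter> B = {}"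
        using partition_onD2[OF partS] T(1) unfolding disjoint_def by blast
      have eq: "(\<Sum>x\<in>socle p. g x) = (\<Sum>A\<in>T. \<Sum>x\<in>A. g x)" for g :: "'a \<Rightarrow> complex"
        unfolding T(2) using finite_block T(1) dis sum.Union_disjoint[of T g] by fastforce
      have hatT: "(\<Sum>x\<in>A. \<chi> (a \<otimes> x)) = (\<Sum>x\<in>A. \<chi> (\<one> \<otimes> x))" if "A \<in> T" for A
        using a T(1) that unfolding L_def hat_def by blast
      have "(\<Sum>x\<in>socle p. \<chi> (a \<otimes> x)) = (\<Sum>x\<in>socle p. \<chi> (\<one> \<otimes> x))"
        unfolding eq by (intro sum.cong refl hatT)
      moreover have "(\<Sum>x\<in>socle p. \<chi> (a \<otimes> x)) = of_nat (card (socle p))"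
        by (simp add: z)
      moreover have "(\<Sum>x\<in>socle p. \<chi> (\<one> \<otimes> x)) = (\<Sum>x\<in>socle p. \<chi> x)"
        by (intro sum.cong refl) auto
      moreover have "(\<Sum>x\<in>socle p. \<chi> x) = \<chi> h * (\<Sum>x\<in>socle p. \<chi> x)"
      proof -
        have "bij_betw (\<lambda>x. h \<oplus> x) (socle p) (socle p)"
          by (rule bij_betwI[of _ _ _ "\<lambda>x. \<ominus> h \<oplus> x"])
            (use h hc in \<open>auto simp: r_neg1 r_neg2\<close>)
        then have "(\<Sum>x\<in>socle p. \<chi> x) = (\<Sum>x\<in>socle p. \<chi> (h \<oplus> x))"
          by (rule sum.reindex_bij_betw[symmetric])
        also have "\<dots> = \<chi> h * (\<Sum>x\<in>socle p. \<chi> x)"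
          unfolding sum_distrib_left using hc by (intro sum.cong refl) (auto simp: chi_add)
        finally show ?thesis .
      qed
      ultimately have "card (socle p) = 0" using h(2) by simp
      moreover have "finite (socle p)" using finite_carrier by (simp add: socle_def)
      ultimately show False using h(1) by auto
    qed
  qed
qed

lemma unit_group_L: "unit_group L"
proof -
  have U: "a \<in> Units R" if "a \<in> L" for a using that L_subset_Units by blast
  have "\<one> \<in> L" by (simp add: L_def)
  moreover have "a \<otimes> b \<in> L" if "a \<in> L" "b \<in> L" for a b
    using that hat_mult_L[OF that(2) _ U[OF that(1)]] by (simp add: L_def)
  moreover have "inv a \<in> L" if "a \<in> L" for a
    using that hat_mult_L[OF that, of _ "inv a"] U[OF that] by (simp add: L_def)
  ultimately show ?thesis unfolding unit_group_def using L_subset_Units by blast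
qed

lemma coset_swap:
  assumes J: "unit_group J" and n: "n \<in> carrier R" and k: "k \<in> Units R"
    and "n \<in> (\<otimes>) (n \<otimes> k) ` J"
  shows "n \<otimes> k \<in> (\<otimes>) n ` J"
proof -
  obtain j where j: "j \<in> J" "n = n \<otimes> k \<otimes> j" using assms by blast
  have ju: "j \<in> Units R" by (rule unit_groupD(1)[OF J j(1)])
  have "n \<otimes> inv j = n \<otimes> k \<otimes> j \<otimes> inv j" using j(2) by simp
  also have "\<dots> = n \<otimes> k" using n k ju by (simp add: m_assoc Units_closed)
  finally show ?thesis using unit_groupD(5)[OF J j(1)] by (metis image_eqI)
qed

text \<open>The transforms of \<open>K\<close> and of its translate by \<open>b\<close> agree at
  every unit by \<open>hat_mult_L\<close>, so these two cosets cannot be distinct.\<close>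

lemma L_subset_K: "L \<subseteq> K"
proof
  fix b assume b: "b \<in> L"
  have bu: "b \<in> Units R" using b L_subset_Units by blast
  show "b \<in> K"
  proof (rule ccontr)
    assume nb: "b \<notin> K"
    have KS: "K \<in> S" unfolding K_def by (rule block_mem) simp
    have oneK: "(\<otimes>) \<one> ` K = K" using S_subset[OF KS] by force
    have n1: "\<one> \<notin> (\<otimes>) b ` K"
      using coset_swap[OF unit_group_K one_closed bu] nb oneK Units_closed[OF bu] by auto
    define f where "f x = of_bool (x \<in> K) - (of_bool (x \<in> (\<otimes>) b ` K) :: complex)" for x
    have "\<exists>w\<in>Units R. fourier f w \<noteq> 0"
    proof (rule fourier_separates_cosets[OF tame_one _ unit_group_K n1])
      show "tame b" using tame_mult_unit[OF tame_one bu] Units_closed[OF bu] by simp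
      show "f \<one> \<noteq> 0" using n1 unit_groupD(3)[OF unit_group_K] by (simp add: f_def)
    qed (use oneK in \<open>auto simp: f_def\<close>)
    then obtain w where w: "w \<in> Units R" "fourier f w \<noteq> 0" by blast
    have "fourier f w = hat K w - hat ((\<otimes>) b ` K) w"
      unfolding f_def fourier_diff using S_subset[OF KS] S_subset[OF unitS[OF KS bu]]
      by (simp add: fourier_indicator)
    also have "\<dots> = 0"
      using hat_unit[OF S_subset[OF KS] bu] hat_mult_L[OF b KS w(1)] Units_closed[OF w(1)] by simp
    finally show False using w(2) by simp
  qed
qed

section \<open>Convolution and interpolation of functions constant on basic sets\<close>

definition S_invariant :: "('a \<Rightarrow> complex) \<Rightarrow> bool" where
  "S_invariant f \<longleftrightarrow> (\<forall>A\<in>S. \<forall>x\<in>A. \<forall>y\<in>A. f x = f y)"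

definition conv :: "('a \<Rightarrow> complex) \<Rightarrow> ('a \<Rightarrow> complex) \<Rightarrow> 'a \<Rightarrow> complex" where
  "conv f g z = (\<Sum>x\<in>carrier R. \<Sum>y\<in>carrier R. if x \<oplus> y = z then f x * g y else 0)"

lemma sum_carrier_S: "(\<Sum>x\<in>carrier R. g x) = (\<Sum>A\<in>S. \<Sum>x\<in>A. g x :: complex)"
proof -
  have "\<forall>A\<in>S. \<forall>B\<in>S. A \<noteq> B \<longrightarrow> A \<inter> B = {}"
    using partition_onD2[OF partS] unfolding disjoint_def by blast
  then show ?thesis
    unfolding partition_onD1[OF partS] using finite_block sum.Union_disjoint[of S g] by fastforce
qed

lemma fourier_conv: "a \<in> carrier R \<Longrightarrow> fourier (conv f g) a = fourier f a * fourier g a"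
proof -
  assume a: "a \<in> carrier R"
  have "fourier (conv f g) a =
    (\<Sum>z\<in>carrier R. \<Sum>x\<in>carrier R. \<Sum>y\<in>carrier R. if x \<oplus> y = z then f x * g y * \<chi> (a \<otimes> z) else 0)"
    unfolding fourier_def conv_def sum_distrib_right by (intro sum.cong refl) simp
  also have "\<dots> = (\<Sum>x\<in>carrier R. \<Sum>z\<in>carrier R. \<Sum>y\<in>carrier R. if x \<oplus> y = z then f x * g y * \<chi> (a \<otimes> z) else 0)"
    by (rule sum.swap)
  also have "\<dots> = (\<Sum>x\<in>carrier R. \<Sum>y\<in>carrier R. \<Sum>z\<in>carrier R. if x \<oplus> y = z then f x * g y * \<chi> (a \<otimes> z) else 0)"
    by (intro sum.cong refl sum.swap)
  also have "\<dots> = (\<Sum>x\<in>carrier R. \<Sum>y\<in>carrier R. (f x * \<chi> (a \<otimes> x)) * (g y * \<chi> (a \<otimes> y)))"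
    using a finite_carrier by (intro sum.cong refl) (simp add: r_distr chi_add)
  also have "\<dots> = fourier f a * fourier g a"
    unfolding fourier_def by (simp add: sum_product)
  finally show ?thesis .
qed

text \<open>Grouping both sums by basic sets expresses the convolution through the counts of
  \<open>convS\<close>.\<close>

lemma S_invariant_conv:
  assumes f: "S_invariant f" and g: "S_invariant g"
  shows "S_invariant (conv f g)"
proof -
  define r where "r A = (SOME x. x \<in> A)" for A :: "'a set"
  have r: "r A \<in> A" if "A \<in> S" for A
    unfolding r_def using partition_onD3[OF partS] that by (metis someI_ex ex_in_conv)
  have eq: "conv f g z = (\<Sum>A\<in>S. \<Sum>Y\<in>S. f (r A) * g (r Y) * (\<Sum>x\<in>A. \<Sum>y\<in>Y. if x \<oplus> y = z then 1 else 0))" for z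
  proof -
    have "conv f g z = (\<Sum>A\<in>S. \<Sum>x\<in>A. \<Sum>Y\<in>S. \<Sum>y\<in>Y. if x \<oplus> y = z then f x * g y else 0)"
      unfolding conv_def sum_carrier_S ..
    also have "\<dots> = (\<Sum>A\<in>S. \<Sum>Y\<in>S. \<Sum>x\<in>A. \<Sum>y\<in>Y. if x \<oplus> y = z then f x * g y else 0)"
      by (intro sum.cong refl sum.swap)
    also have "\<dots> = (\<Sum>A\<in>S. \<Sum>Y\<in>S. \<Sum>x\<in>A. \<Sum>y\<in>Y. f (r A) * g (r Y) * (if x \<oplus> y = z then 1 else 0))"
    proof (intro sum.cong refl)
      fix A Y x y assume "A \<in> S" "Y \<in> S" "x \<in> A" "y \<in> Y"
      then have "f x = f (r A)" "g y = g (r Y)"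
        using f[unfolded S_invariant_def, rule_format, of A x "r A"]
          g[unfolded S_invariant_def, rule_format, of Y y "r Y"] r by simp_all
      then show "(if x \<oplus> y = z then f x * g y else 0) = f (r A) * g (r Y) * (if x \<oplus> y = z then 1 else 0)"
        by simp
    qed
    finally show ?thesis unfolding sum_distrib_left .
  qed
  show ?thesis
    unfolding S_invariant_def
  proof (intro ballI)
    fix Z z z' assume z: "Z \<in> S" "z \<in> Z" "z' \<in> Z"
    show "conv f g z = conv f g z'"
      unfolding eq
    proof (rule sum.cong[OF refl], rule sum.cong[OF refl])
      fix A Y assume "A \<in> S" "Y \<in> S"
      show "f (r A) * g (r Y) * (\<Sum>x\<in>A. \<Sum>y\<in>Y. if x \<oplus> y = z then 1 else 0) =
          f (r A) * g (r Y) * (\<Sum>x\<in>A. \<Sum>y\<in>Y. if x \<oplus> y = z' then 1 else 0)"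
        by (simp only: convS[OF \<open>A \<in> S\<close> \<open>Y \<in> S\<close> z])
    qed
  qed
qed

lemma S_invariant_indicator: "A \<in> S \<Longrightarrow> S_invariant (\<lambda>x. of_bool (x \<in> A))"
  unfolding S_invariant_def
proof (intro ballI)
  fix B x y assume A: "A \<in> S" and B: "B \<in> S" "x \<in> B" "y \<in> B"
  have "x \<in> A \<longleftrightarrow> A = B" "y \<in> A \<longleftrightarrow> A = B"
    using block_eq[OF A, of x] block_eq[OF A, of y] block_eq[OF B(1,2)] block_eq[OF B(1,3)] B by auto
  then show "of_bool (x \<in> A) = (of_bool (y \<in> A) :: complex)" by simp
qed

lemma fourier_L:
  assumes "S_invariant f" "a \<in> L"
  shows "fourier f a = fourier f \<one>"
proof -
  have "(\<Sum>x\<in>A. f x * \<chi> (a \<otimes> x)) = (\<Sum>x\<in>A. f x * \<chi> (\<one> \<otimes> x))" if A: "A \<in> S" for A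
  proof -
    obtain y where y: "y \<in> A" using partition_onD3[OF partS] A by (metis ex_in_conv)
    have fy: "f x = f y" if "x \<in> A" for x using assms(1) A y that unfolding S_invariant_def by blast
    have "hat A a = hat A \<one>" using assms(2) A by (simp add: L_def)
    then have "(\<Sum>x\<in>A. f y * \<chi> (a \<otimes> x)) = (\<Sum>x\<in>A. f y * \<chi> (\<one> \<otimes> x))"
      unfolding hat_def sum_distrib_left[symmetric] by simp
    then show ?thesis using fy by (simp cong: sum.cong)
  qed
  then show ?thesis unfolding fourier_def sum_carrier_S by (rule sum.cong[OF refl])
qed

text \<open>Lagrange interpolation on the frequencies: for \<open>b\<close> outside \<open>L\<close>
  some \<open>hat A\<close> separates \<open>b\<close> from \<one>, which yields a factor with
  transform 0 at \<open>b\<close> and 1 at \<one>. Convolving the factors multiplies their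
  transforms.\<close>

lemma interpolate_L:
  assumes "finite B" "B \<subseteq> carrier R - L"
  shows "\<exists>f. S_invariant f \<and> fourier f \<one> = 1 \<and> (\<forall>b\<in>B. fourier f b = 0)"
  using assms
proof (induction B rule: finite_induct)
  \<comment> \<open>The identity for convolution: its transform is constantly 1, so subtracting a
    multiple of it shifts a transform by a constant.\<close>
  define d where "d x = (of_bool (x \<in> {\<zero>}) :: complex)" for x
  have d: "S_invariant d" unfolding d_def using zeroS by (rule S_invariant_indicator)
  have fd: "fourier d a = 1" if "a \<in> carrier R" for a
    unfolding d_def using that fourier_indicator[of "{\<zero>}" a] by (simp add: hat_def)
  {
    case empty
    then show ?case using d fd by blast
  next
    case (insert b B)
    then obtain f where f: "S_invariant f" "fourier f \<one> = 1" "\<forall>b\<in>B. fourier f b = 0" by auto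
    have b: "b \<in> carrier R" "b \<notin> L" using insert.prems by auto
    then obtain A where A: "A \<in> S" "hat A b \<noteq> hat A \<one>" by (auto simp: L_def)
    define g where "g x = (of_bool (x \<in> A) - hat A b * d x) / (hat A \<one> - hat A b)" for x
    have g: "S_invariant g"
      using S_invariant_indicator[OF A(1)] d unfolding S_invariant_def g_def by metis
    have fg: "fourier g a = (hat A a - hat A b) / (hat A \<one> - hat A b)" if "a \<in> carrier R" for a
    proof -
      have "fourier g a = (fourier (\<lambda>x. of_bool (x \<in> A)) a - hat A b * fourier d a) / (hat A \<one> - hat A b)"
        unfolding fourier_def g_def sum_distrib_left sum_subtractf[symmetric] sum_divide_distrib
        by (intro sum.cong refl) (simp add: algebra_simps)
      then show ?thesis using fd[OF that] fourier_indicator[OF S_subset[OF A(1)]] by simp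
    qed
    have "S_invariant (conv f g)" by (rule S_invariant_conv[OF f(1) g])
    moreover have "fourier (conv f g) \<one> = 1" using f(2) fg[of \<one>] A(2) by (simp add: fourier_conv)
    moreover have "fourier (conv f g) c = 0" if "c \<in> insert b B" for c
    proof -
      have "c \<in> carrier R" using that insert.prems by auto
      then show ?thesis using that f(3) fg[OF b(1)] by (auto simp: fourier_conv)
    qed
    ultimately show ?case by blast
  }
qed

definition D :: "'a \<Rightarrow> complex" where
  "D z = (\<Sum>a\<in>L. \<chi> (a \<otimes> z))"

text \<open>By interpolation and \<open>fourier_L\<close>, the indicator of \<open>L\<close> is the
  transform of a function constant on basic sets. Inversion identifies that function with
  \<open>D\<close>, up to the factor \<open>order R\<close> and the sign of the argument.\<close>

lemma D_block:
  assumes z: "z \<in> carrier R" and z': "z' \<in> block z"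
  shows "D z = D z'"
proof -
  have "finite (carrier R - L)" using finite_carrier by simp
  then obtain f where f: "S_invariant f" "fourier f \<one> = 1" "\<forall>b\<in>carrier R - L. fourier f b = 0"
    using interpolate_L[of "carrier R - L"] by blast
  have LR: "L \<subseteq> carrier R" by (auto simp: L_def)
  have "D n = of_nat (order R) * f (\<ominus> n)" if n: "n \<in> carrier R" for n
  proof -
    have "of_nat (order R) * f (\<ominus> n) = (\<Sum>a\<in>carrier R. fourier f a * \<chi> (\<ominus> (a \<otimes> \<ominus> n)))"
      by (rule fourier_inversion[symmetric]) (use n in simp)
    also have "\<dots> = (\<Sum>a\<in>L. fourier f a * \<chi> (\<ominus> (a \<otimes> \<ominus> n)))"
      using f(3) by (intro sum.mono_neutral_right finite_carrier LR) auto
    also have "\<dots> = D n"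
      unfolding D_def using fourier_L[OF f(1)] f(2) n LR
      by (intro sum.cong refl) (auto simp: r_minus subset_iff)
    finally show ?thesis by simp
  qed
  moreover have "f (\<ominus> z) = f (\<ominus> z')"
  proof -
    \<comment> \<open>Negation is multiplication by a unit, so it maps the basic set of
      \<open>z\<close> to a basic set.\<close>
    have u: "\<ominus> \<one> \<in> Units R" using Units_minus_one_closed .
    have z'c: "z' \<in> carrier R" using block_carrier z z' by blast
    have m: "\<ominus> x = \<ominus> \<one> \<otimes> x" if "x \<in> carrier R" for x using that by (simp add: l_minus)
    have zz: "\<ominus> z \<in> (\<otimes>) (\<ominus> \<one>) ` block z" "\<ominus> z' \<in> (\<otimes>) (\<ominus> \<one>) ` block z"
      unfolding m[OF z] m[OF z'c] by (intro imageI block_mem(2)[OF z] z')+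
    have "(\<otimes>) (\<ominus> \<one>) ` block z \<in> S" by (rule unitS[OF block_mem(1)[OF z] u])
    then show ?thesis by (rule f(1)[unfolded S_invariant_def, rule_format, OF _ zz])
  qed
  ultimately show ?thesis using z block_carrier[OF z z'] by simp
qed

lemma block_unit_mult:
  assumes "w \<in> Units R" "x \<in> carrier R" "y \<in> block x"
  shows "w \<otimes> y \<in> block (w \<otimes> x)"
  using assms block_unit by auto

lemma hat_L: "w \<in> carrier R \<Longrightarrow> hat L w = D w"
  unfolding hat_def D_def by (intro sum.cong refl) (auto simp: L_def m_comm)

text \<open>For \<open>k\<close> in \<open>K\<close> and a unit \<open>w\<close>, the elements
  \<open>w\<close> and \<open>w \<otimes> k\<close> share a basic set; by \<open>D_block\<close> the
  transforms of \<open>L\<close> and of its translate by \<open>k\<close> agree at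
  \<open>w\<close>.\<close>

lemma L_eq_K: "L = K"
proof
  show "L \<subseteq> K" by (rule L_subset_K)
  show "K \<subseteq> L"
  proof
    fix k assume k: "k \<in> K"
    have ku: "k \<in> Units R" by (rule unit_groupD(1)[OF unit_group_K k])
    show "k \<in> L"
    proof (rule ccontr)
      assume nk: "k \<notin> L"
      have LR: "L \<subseteq> carrier R" by (auto simp: L_def)
      have oneL: "(\<otimes>) \<one> ` L = L" using LR by force
      have n1: "\<one> \<notin> (\<otimes>) k ` L"
        using coset_swap[OF unit_group_L one_closed ku] nk oneL Units_closed[OF ku] by auto
      define f where "f x = of_bool (x \<in> L) - (of_bool (x \<in> (\<otimes>) k ` L) :: complex)" for x
      have "\<exists>w\<in>Units R. fourier f w \<noteq> 0"
      proof (rule fourier_separates_cosets[OF tame_one _ unit_group_L n1])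
        show "tame k" using tame_mult_unit[OF tame_one ku] Units_closed[OF ku] by simp
        show "f \<one> \<noteq> 0" using n1 unit_groupD(3)[OF unit_group_L] by (simp add: f_def)
        show "(\<otimes>) \<one> ` L \<subseteq> (\<otimes>) \<one> ` K" using L_subset_K by blast
      qed (use oneL in \<open>auto simp: f_def\<close>)
      then obtain w where w: "w \<in> Units R" "fourier f w \<noteq> 0" by blast
      note wc = Units_closed[OF w(1)]
      have "(\<otimes>) k ` L \<subseteq> carrier R" using LR ku by auto
      then have "fourier f w = hat L w - hat ((\<otimes>) k ` L) w"
        unfolding f_def fourier_diff using LR by (simp add: fourier_indicator)
      also have "hat ((\<otimes>) k ` L) w = hat L (w \<otimes> k)" by (rule hat_unit[OF LR ku wc])
      also have "hat L w = hat L (w \<otimes> k)"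
        using hat_L wc Units_closed[OF ku] D_block[OF wc, of "w \<otimes> k"] block_unit_mult[OF w(1) one_closed, of k] k
        by (simp add: K_def)
      finally show False using w(2) by simp
    qed
  qed
qed

section \<open>Basic sets are orbits of \<open>K\<close>\<close>

lemma fourier_orbit_sum:
  assumes "n \<in> carrier R" "a \<in> carrier R"
  shows "fourier (\<lambda>x. \<Sum>k\<in>K. of_bool (n \<otimes> k = x)) a = D (a \<otimes> n)"
proof -
  have KR: "k \<in> carrier R" if "k \<in> K" for k by (rule unit_groupD(2)[OF unit_group_K that])
  have "fourier (\<lambda>x. \<Sum>k\<in>K. of_bool (n \<otimes> k = x)) a =
      (\<Sum>k\<in>K. \<Sum>x\<in>carrier R. if n \<otimes> k = x then \<chi> (a \<otimes> x) else 0)"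
    unfolding fourier_def sum_distrib_right by (subst sum.swap) (intro sum.cong refl, simp)
  also have "\<dots> = (\<Sum>k\<in>K. \<chi> (k \<otimes> (a \<otimes> n)))"
    using assms KR finite_carrier by (intro sum.cong refl) (simp add: m_ac)
  finally show ?thesis by (simp add: D_def L_eq_K)
qed

text \<open>For a unit \<open>w\<close>, also \<open>w \<otimes> m\<close> and
  \<open>w \<otimes> n\<close> share a basic set, so by \<open>D_block\<close> the weighted orbits
  of \<open>m\<close> and \<open>n\<close> have equal transforms at units.\<close>

lemma tame_block_subset:
  assumes n: "tame n" and m: "m \<in> block n"
  shows "m \<in> (\<otimes>) n ` K"
proof (rule ccontr)
  assume nm: "m \<notin> (\<otimes>) n ` K"
  note nc = tame_carrier[OF n]
  have mc: "m \<in> carrier R" using block_carrier[OF nc m] .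
  have fK: "finite K" unfolding K_def by (intro finite_block block_mem) simp
  obtain r where "r \<in> carrier R" "n = m \<otimes> r" using block_dvd[OF nc m] by blast
  then have tm: "tame m" using n tame_factor mc by blast
  have nm': "n \<notin> (\<otimes>) m ` K"
  proof
    assume "n \<in> (\<otimes>) m ` K"
    then obtain k where k: "k \<in> K" "n = m \<otimes> k" by blast
    have ku: "k \<in> Units R" by (rule unit_groupD(1)[OF unit_group_K k(1)])
    have "m = n \<otimes> inv k" unfolding k(2) using mc ku by (simp add: m_assoc Units_closed)
    then show False using nm unit_groupD(5)[OF unit_group_K k(1)] by blast
  qed
  \<comment> \<open>Each point of an orbit is weighted by the number of \<open>k\<close> producing
    it, since \<open>k\<close> may act non-injectively on a non-unit. With this weight the transform
    is exactly \<open>D\<close> by \<open>fourier_orbit_sum\<close>.\<close>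
  define f where "f x = (\<Sum>k\<in>K. of_bool (n \<otimes> k = x)) - (\<Sum>k\<in>K. of_bool (m \<otimes> k = x) :: complex)" for x
  have "\<exists>w\<in>Units R. fourier f w \<noteq> 0"
  proof (rule fourier_separates_cosets[OF n tm unit_group_K nm' subset_refl])
    have "(\<Sum>k\<in>K. of_bool (m \<otimes> k = n) :: complex) = 0"
      using nm' by (intro sum.neutral) auto
    moreover have "(\<Sum>k\<in>K. of_bool (n \<otimes> k = n) :: complex) \<noteq> 0"
    proof -
      have "(\<Sum>k\<in>K. of_bool (n \<otimes> k = n) :: complex) = of_nat (card {k\<in>K. n \<otimes> k = n})"
        using fK by (simp add: of_bool_def sum.If_cases Int_def)
      moreover have "finite {k\<in>K. n \<otimes> k = n}" using fK by simp
      moreover have "{k\<in>K. n \<otimes> k = n} \<noteq> {}" using nc unit_groupD(3)[OF unit_group_K] r_one by blast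
      ultimately show ?thesis by (simp only: of_nat_eq_0_iff card_0_eq) simp
    qed
    ultimately show "f n \<noteq> 0" by (simp add: f_def)
    show "f x = 0" if "x \<notin> (\<otimes>) n ` K" "x \<notin> (\<otimes>) m ` K" for x
      unfolding f_def using that by (subst (1 2) sum.neutral) auto
  qed
  then obtain w where w: "w \<in> Units R" "fourier f w \<noteq> 0" by blast
  note wc = Units_closed[OF w(1)]
  have "fourier f w = D (w \<otimes> n) - D (w \<otimes> m)"
    unfolding f_def fourier_diff using fourier_orbit_sum nc mc wc by simp
  also have "\<dots> = 0"
    using D_block[of "w \<otimes> n" "w \<otimes> m"] block_unit_mult[OF w(1) nc m] wc nc by simp
  finally show False using w(2) by simp
qed

text \<open>The basic set of \<open>n\<close> is the coset of \<open>n\<close> under its stabiliser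
  \<open>J\<close> in \<open>K\<close>. If some \<open>k\<close> in \<open>K\<close> moved
  \<open>n\<close> out of it, the translate by \<open>k\<close> would be another coset of
  \<open>J\<close> with the same transform at units, because \<open>K = L\<close>.\<close>

lemma tame_block:
  assumes n: "tame n"
  shows "block n = (\<otimes>) n ` K"
proof
  show sub: "block n \<subseteq> (\<otimes>) n ` K" using tame_block_subset[OF n] by blast
  note nc = tame_carrier[OF n]
  note KU = unit_groupD(1)[OF unit_group_K] and KR = unit_groupD(2)[OF unit_group_K]
  define J where "J = {u\<in>K. n \<otimes> u \<in> block n}"
  have nJ: "(\<otimes>) n ` J = block n" using sub by (auto simp: J_def)
  have stab: "(\<otimes>) u ` block n = block n" if u: "u \<in> J" for u
  proof -
    have uK: "u \<in> K" "n \<otimes> u \<in> block n" using u by (auto simp: J_def)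
    show ?thesis
      using block_unit[OF KU[OF uK(1)] nc] block_cong[OF nc uK(2)] m_comm[OF nc KR[OF uK(1)]] by simp
  qed
  have J: "unit_group J"
    unfolding unit_group_def
  proof (intro conjI ballI)
    show "J \<subseteq> Units R" using KU by (auto simp: J_def)
    show "\<one> \<in> J" using unit_groupD(3)[OF unit_group_K] nc block_mem by (simp add: J_def)
    fix u assume u: "u \<in> J"
    then have uK: "u \<in> K" by (simp add: J_def)
    show "u \<otimes> v \<in> J" if v: "v \<in> J" for v
    proof -
      have vK: "v \<in> K" "n \<otimes> v \<in> block n" using v by (auto simp: J_def)
      have "u \<otimes> (n \<otimes> v) \<in> block n" using stab[OF u] vK(2) by blast
      then have "n \<otimes> (u \<otimes> v) \<in> block n" using nc KR[OF uK] KR[OF vK(1)] by (simp add: m_lcomm)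
      then show ?thesis using unit_groupD(4)[OF unit_group_K uK vK(1)] by (simp add: J_def)
    qed
    have "n \<in> (\<otimes>) u ` block n" using stab[OF u] block_mem(2)[OF nc] by simp
    then obtain y where y: "y \<in> block n" "n = u \<otimes> y" by blast
    have "n \<otimes> inv u = y"
      unfolding y(2) using KU[OF uK] block_carrier[OF nc y(1)] m_comm[of u y] KR[OF uK] by (simp add: m_assoc)
    then show "inv u \<in> J" using unit_groupD(5)[OF unit_group_K uK] y(1) by (simp add: J_def)
  qed
  show "(\<otimes>) n ` K \<subseteq> block n"
  proof
    fix m assume "m \<in> (\<otimes>) n ` K"
    then obtain k where k: "k \<in> K" "m = n \<otimes> k" by blast
    note ku = KU[OF k(1)] and kc = KR[OF k(1)]
    show "m \<in> block n"
    proof (rule ccontr)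
      assume nm: "m \<notin> block n"
      have B: "block n \<in> S" by (rule block_mem[OF nc])
      have nmJ: "n \<notin> (\<otimes>) m ` J"
        using coset_swap[OF J nc ku] nm unfolding nJ k(2) by blast
      have mJ: "(\<otimes>) m ` J = (\<otimes>) k ` block n"
        unfolding nJ[symmetric] image_image k(2)
        using nc kc KR by (intro image_cong refl) (auto simp: J_def m_ac)
      define f where "f x = of_bool (x \<in> block n) - (of_bool (x \<in> (\<otimes>) k ` block n) :: complex)" for x
      have "\<exists>w\<in>Units R. fourier f w \<noteq> 0"
      proof (rule fourier_separates_cosets[OF n _ J nmJ])
        show "tame m" unfolding k(2) by (rule tame_mult_unit[OF n ku])
        show "(\<otimes>) n ` J \<subseteq> (\<otimes>) n ` K" unfolding nJ by (rule sub)
        show "f n \<noteq> 0" using nmJ block_mem(2)[OF nc] unfolding mJ by (simp add: f_def)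
        show "f x = 0" if "x \<notin> (\<otimes>) n ` J" "x \<notin> (\<otimes>) m ` J" for x
          using that unfolding mJ nJ by (simp add: f_def)
      qed
      then obtain w where w: "w \<in> Units R" "fourier f w \<noteq> 0" by blast
      have "fourier f w = hat (block n) w - hat ((\<otimes>) k ` block n) w"
        unfolding f_def fourier_diff using S_subset[OF B] S_subset[OF unitS[OF B ku]]
        by (simp add: fourier_indicator)
      also have "\<dots> = 0"
        using hat_unit[OF S_subset[OF B] ku] hat_mult_L[OF _ B w(1)] k(1) L_eq_K Units_closed[OF w(1)] by simp
      finally show False using w(2) by simp
    qed
  qed
qed

text \<open>By density \<open>i\<close> lies in a basic set \<open>Y\<close> inside
  \<open>I\<close>. Then \<open>x \<oplus> i\<close> is a sum from \<open>A\<close> and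
  \<open>Y\<close>, and by \<open>convS\<close> so is every element of its basic set.\<close>

lemma block_plus_ideal:
  assumes I: "ideal I R" and A: "A \<in> S" "x \<in> A" and i: "i \<in> I" and z: "z \<in> block (x \<oplus> i)"
  shows "\<exists>x'\<in>A. \<exists>i'\<in>I. z = x' \<oplus> i'"
proof -
  obtain T where T: "T \<subseteq> S" "I = \<Union>T" using denseS[OF I] by blast
  then obtain Y where Y: "Y \<in> T" "i \<in> Y" using i by blast
  have YS: "Y \<in> S" using T Y by blast
  have c: "x \<oplus> i \<in> carrier R" using S_subset[OF A(1)] S_subset[OF YS] A Y by blast
  define N where "N z = (\<Sum>x\<in>A. \<Sum>y\<in>Y. if x \<oplus> y = z then 1 else 0 :: complex)" for z
  have N: "N z = of_nat (\<Sum>x\<in>A. \<Sum>y\<in>Y. if x \<oplus> y = z then 1 else 0)" for z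
    unfolding N_def by (simp add: if_distrib cong: if_cong)
  have "N (x \<oplus> i) = N z"
    unfolding N_def by (rule convS[OF A(1) YS block_mem(1)[OF c] block_mem(2)[OF c] z])
  moreover have "N (x \<oplus> i) \<noteq> 0"
    unfolding N of_nat_eq_0_iff using A Y finite_block[OF A(1)] finite_block[OF YS] by auto
  ultimately have Nz: "N z \<noteq> 0" by simp
  have "\<exists>x\<in>A. \<exists>y\<in>Y. x \<oplus> y = z"
  proof (rule ccontr)
    assume "\<not> (\<exists>x\<in>A. \<exists>y\<in>Y. x \<oplus> y = z)"
    then have "N z = 0" unfolding N_def by (intro sum.neutral ballI) simp
    with Nz show False ..
  qed
  then show ?thesis using Y T by blast
qed

text \<open>Induction on the number of vanishing components. Adding \<open>e = idem p\<close> fills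
  one of them, and multiplication by \<open>\<one> \<ominus> e\<close> undoes this: it kills the
  ideal \<open>I\<close> of \<open>e\<close> and fixes \<open>I'\<close>, which contains
  \<open>block x\<close> by density.\<close>

lemma block_eq_orbit:
  assumes "x \<in> carrier R"
  shows "block x = (\<otimes>) x ` K"
  using assms
proof (induction "card {p\<in>primes. idem p \<otimes> x = \<zero>}" arbitrary: x rule: less_induct)
  case less
  note x = less.prems
  show ?case
  proof (cases "tame x")
    case True
    then show ?thesis by (rule tame_block)
  next
    case False
    then obtain p where p: "p \<in> primes" "idem p \<otimes> x = \<zero>" using x by (auto simp: tame_def)
    define e where "e = idem p"
    have e: "e \<in> carrier R" "e \<otimes> x = \<zero>" "e \<otimes> e = e" using p idem_idem by (auto simp: e_def)
    define x' where "x' = x \<oplus> e"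
    have x': "x' \<in> carrier R" using x e by (simp add: x'_def)
    have e0: "e \<noteq> \<zero>" using tame_one p(1) by (auto simp: tame_def e_def)
    have "{q\<in>primes. idem q \<otimes> x' = \<zero>} \<subset> {q\<in>primes. idem q \<otimes> x = \<zero>}"
    proof -
      have q: "idem q \<otimes> x' = (if q = p then e else idem q \<otimes> x)" if "q \<in> primes" for q
        using that x e p idem_orthogonal[OF that p(1)] by (simp add: x'_def r_distr e_def)
      have "p \<notin> {q\<in>primes. idem q \<otimes> x' = \<zero>}" using q[OF p(1)] e0 by simp
      moreover have "{q\<in>primes. idem q \<otimes> x' = \<zero>} \<subseteq> {q\<in>primes. idem q \<otimes> x = \<zero>}"
        using q e0 by (auto split: if_splits)
      ultimately show ?thesis using p by blast
    qed
    then have "card {q\<in>primes. idem q \<otimes> x' = \<zero>} < card {q\<in>primes. idem q \<otimes> x = \<zero>}"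
      using finite_primes by (intro psubset_card_mono) auto
    then have IH: "block x' = (\<otimes>) x' ` K" using less.hyps x' by blast
    define I where "I = PIdl e"
    define I' where "I' = PIdl (\<one> \<ominus> e)"
    have I: "ideal I R" and I': "ideal I' R" unfolding I_def I'_def using e by (auto intro: cgenideal_ideal)
    have eI: "e \<in> I" unfolding I_def using e cgenideal_self by blast
    have xI': "x \<in> I'"
    proof -
      have "x \<otimes> (\<one> \<ominus> e) = x" using x e m_comm[of e x] by (simp add: a_minus_def r_distr r_minus)
      then show ?thesis unfolding I'_def cgenideal_def using x by (metis (mono_tags, lifting) mem_Collect_eq)
    qed
    have proj_I: "i \<otimes> (\<one> \<ominus> e) = \<zero>" if "i \<in> I" for i
    proof -
      obtain r where r: "r \<in> carrier R" "i = r \<otimes> e" using \<open>i \<in> I\<close> unfolding I_def cgenideal_def by blast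
      have "e \<otimes> (\<one> \<ominus> e) = \<zero>" using e by (simp add: a_minus_def r_distr r_minus r_neg)
      then show ?thesis unfolding r(2) using r(1) e by (simp add: m_assoc)
    qed
    have proj_I': "y \<otimes> (\<one> \<ominus> e) = y" if "y \<in> I'" for y
    proof -
      obtain r where r: "r \<in> carrier R" "y = r \<otimes> (\<one> \<ominus> e)" using \<open>y \<in> I'\<close> unfolding I'_def cgenideal_def by blast
      have "(\<one> \<ominus> e) \<otimes> (\<one> \<ominus> e) = \<one> \<ominus> e"
        using e by (simp add: a_minus_def r_distr l_distr r_minus l_minus a_assoc l_neg r_neg r_neg1 r_neg2)
      then show ?thesis unfolding r(2) using r(1) e by (simp add: m_assoc)
    qed
    have IR: "i \<in> carrier R" if "i \<in> I" for i using ideal.Icarr[OF I that] .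
    have I'R: "i \<in> carrier R" if "i \<in> I'" for i using ideal.Icarr[OF I' that] .
    have proj: "y = x \<otimes> k" if "x' \<otimes> k = y \<oplus> i" "k \<in> K" "y \<in> I'" "i \<in> I" for y i k
    proof -
      have kc: "k \<in> carrier R" by (rule unit_groupD(2)[OF unit_group_K that(2)])
      have "x' \<otimes> (\<one> \<ominus> e) = x"
        unfolding x'_def using x e proj_I[OF eI] proj_I'[OF xI'] by (simp add: l_distr)
      moreover have "(x' \<otimes> k) \<otimes> (\<one> \<ominus> e) = (x' \<otimes> (\<one> \<ominus> e)) \<otimes> k"
        using x' kc e by (simp add: m_ac)
      ultimately have xk: "(x' \<otimes> k) \<otimes> (\<one> \<ominus> e) = x \<otimes> k" by (simp only:)
      have "(y \<oplus> i) \<otimes> (\<one> \<ominus> e) = y"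
        using l_distr[OF I'R[OF that(3)] IR[OF that(4)], of "\<one> \<ominus> e"] I'R[OF that(3)] e
          proj_I[OF that(4)] proj_I'[OF that(3)] by simp
      then show ?thesis using xk[unfolded that(1)] by (rule trans[OF sym])
    qed
    have bI': "block x \<subseteq> I'" by (rule block_ideal[OF I' xI'])
    show ?thesis
    proof
      show "block x \<subseteq> (\<otimes>) x ` K"
      proof
        fix y assume y: "y \<in> block x"
        \<comment> \<open>\<open>block_plus_ideal\<close> works in both directions: here from
          \<open>x'\<close> to \<open>x\<close> by adding \<open>\<ominus> e\<close>, in the other
          inclusion from \<open>x\<close> to \<open>x'\<close> by adding \<open>e\<close>.\<close>
        have "x' \<oplus> \<ominus> e = x" unfolding x'_def using x e by (simp add: a_assoc r_neg)
        then have y': "y \<in> block (x' \<oplus> \<ominus> e)" using y by (simp only:)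
        have "\<ominus> e \<in> I" by (rule additive_subgroup.a_inv_closed[OF ideal.axioms(1)[OF I] eI])
        from block_plus_ideal[OF I block_mem(1)[OF x'] block_mem(2)[OF x'] this y']
        obtain z i where z: "z \<in> block x'" "i \<in> I" "y = z \<oplus> i" by blast
        obtain k where k: "k \<in> K" "z = x' \<otimes> k" using z(1) IH by blast
        have zc: "z \<in> carrier R" using block_carrier[OF x' z(1)] .
        have "x' \<otimes> k = y \<oplus> \<ominus> i" unfolding z(3) k(2)[symmetric] using zc IR[OF z(2)] by (simp add: a_assoc r_neg)
        moreover have "\<ominus> i \<in> I" by (rule additive_subgroup.a_inv_closed[OF ideal.axioms(1)[OF I] z(2)])
        ultimately have "y = x \<otimes> k" using proj[of k y "\<ominus> i"] k(1) bI' y by blast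
        then show "y \<in> (\<otimes>) x ` K" using k(1) by blast
      qed
      show "(\<otimes>) x ` K \<subseteq> block x"
      proof
        fix y assume "y \<in> (\<otimes>) x ` K"
        then obtain k where k: "k \<in> K" "y = x \<otimes> k" by blast
        have "x' \<otimes> k \<in> block (x \<oplus> e)" unfolding x'_def[symmetric] IH using k(1) by (rule imageI)
        from block_plus_ideal[OF I block_mem(1)[OF x] block_mem(2)[OF x] eI this]
        obtain z i where z: "z \<in> block x" "i \<in> I" "x' \<otimes> k = z \<oplus> i" by blast
        then have "z = x \<otimes> k" using proj[of k z i] k(1) bI' by blast
        then show "y \<in> block x" using z(1) k(2) by simp
      qed
    qed
  qed
qed

end

section \<open>CG-rings and S-rings\<close>

lemma (in ring) maximalideal_above:
  assumes fin: "finite (carrier R)" and J: "ideal J R" "J \<noteq> carrier R"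
  obtains M where "maximalideal M R" "J \<subseteq> M"
proof -
  define C where "C = {I. ideal I R \<and> J \<subseteq> I \<and> I \<noteq> carrier R}"
  have sub: "I \<subseteq> carrier R" if "ideal I R" for I
    using additive_subgroup.a_subset[OF ideal.axioms(1)[OF that]] .
  have "C \<subseteq> Set.Pow (carrier R)" using sub by (auto simp: C_def)
  then have "finite C" using fin by (meson finite_Pow_iff finite_subset)
  moreover have "J \<in> C" using J by (simp add: C_def)
  ultimately obtain M where M: "M \<in> C" "\<forall>I\<in>C. M \<subseteq> I \<longrightarrow> M = I"
    using finite_has_maximal[of C] by blast
  have "maximalideal M R"
  proof (rule maximalidealI)
    show "ideal M R" "carrier R \<noteq> M" using M(1) by (auto simp: C_def)
    show "I = M \<or> I = carrier R" if "ideal I R" "M \<subseteq> I" "I \<subseteq> carrier R" for I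
    proof (rule ccontr)
      assume "\<not> (I = M \<or> I = carrier R)"
      then have "I \<in> C" "I \<noteq> M" using that M(1) by (auto simp: C_def)
      then show False using M(2) that(2) by blast
    qed
  qed
  then show thesis using that M(1) by (simp add: C_def)
qed

section \<open>Sylow components and the Galois condition\<close>

context finite_cring
begin

lemma emb_annihilator:
  assumes p: "p \<in> primes" and x: "x \<in> carrier R" "emb (p ^ multiplicity p (order R)) \<otimes> x = \<zero>"
  shows "idem p \<otimes> x = x"
proof -
  obtain a where a: "a = multiplicity p (order R)" "[idem_index p = 1] (mod p ^ a)"
    using order_decomp[OF p] by metis
  have "[1 = idem_index p] (mod p ^ a)" using a(2) by (rule cong_sym)
  then obtain k l where kl: "idem_index p + k * p ^ a = 1 + l * p ^ a"
    unfolding cong_iff_lin_nat by blast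
  have z: "emb (k * p ^ a) \<otimes> x = \<zero>" for k
    using x unfolding a(1) emb_mult by (simp add: m_assoc)
  have "emb (idem_index p + k * p ^ a) \<otimes> x = emb (1 + l * p ^ a) \<otimes> x" by (simp only: kl)
  then show ?thesis
    unfolding emb_add using x(1) by (simp add: l_distr z idem_def del: One_nat_def emb_1(2))
qed

definition component :: "nat \<Rightarrow> 'a set" where
  "component p = {x \<in> carrier R. emb (p ^ multiplicity p (order R)) \<otimes> x = \<zero>}"

lemma subgroup_component: "subgroup (component p) (add_monoid R)"
proof (rule add.subgroupI)
  have "\<zero> \<in> component p" by (simp add: component_def)
  then show "component p \<noteq> {}" by blast
qed (auto simp: component_def r_distr r_minus simp flip: a_inv_def)

lemma sylow_subset_component:
  assumes "subgroup H (add_monoid R)" "card H = p ^ multiplicity p (order R)"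
  shows "H \<subseteq> component p"
  using subgroup_card_emb[OF assms(1)] subgroup.subset[OF assms(1)]
  by (auto simp: component_def assms(2))

text \<open>Another prime dividing the cardinality would, by Cauchy's theorem, give a non-zero
  element killed both by it and by a power of \<open>p\<close>. The component also contains a Sylow
  subgroup and its cardinality divides \<open>order R\<close>, which fixes the exponent.\<close>

lemma card_component:
  assumes p: "p \<in> primes"
  shows "card (component p) = p ^ multiplicity p (order R)"
proof -
  obtain a m where a: "a = multiplicity p (order R)" "order R = p ^ a * m" "coprime p m"
    using order_decomp[OF p] by metis
  define C where "C = component p"
  have C: "subgroup C (add_monoid R)" unfolding C_def by (rule subgroup_component)
  have CR: "C \<subseteq> carrier R" by (auto simp: C_def component_def)
  then have fC: "finite C" using finite_carrier finite_subset by blast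
  have dvd: "card C dvd order R"
    using add.lagrange[OF C] by (metis dvd_triv_right order_add_monoid)
  have only_p: "q = p" if q: "Factorial_Ring.prime q" "q dvd card C" for q
  proof (rule ccontr)
    assume qp: "q \<noteq> p"
    interpret C: group "(add_monoid R)\<lparr>carrier := C\<rparr>" by (rule add.subgroup_imp_group[OF C])
    obtain k where k: "card C = q * k" using q by blast
    obtain H where H: "subgroup H ((add_monoid R)\<lparr>carrier := C\<rparr>)" "card H = q ^ 1"
      using sylow_thm[OF q(1) C.is_group, of 1 k] fC k by (auto simp: order_def)
    have HC: "H \<subseteq> C" using subgroup.subset[OF H(1)] by simp
    have HR: "subgroup H (add_monoid R)" by (rule add.incl_subgroup[OF C H(1)])
    have "card H > 1" unfolding H(2) power_one_right using q(1) by (rule prime_gt_1_nat)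
    then have "\<not> H \<subseteq> {\<zero>}" using card_mono[of "{\<zero>}" H] by fastforce
    then obtain x where x: "x \<in> H" "x \<noteq> \<zero>" by blast
    have xc: "x \<in> carrier R" using x HC CR by blast
    have x1: "emb q \<otimes> x = \<zero>" using subgroup_card_emb[OF HR x(1)] H(2) by simp
    have x2: "emb (p ^ a) \<otimes> x = \<zero>" using x(1) HC by (auto simp: C_def component_def a(1))
    have "coprime q (p ^ a)" using q(1) qp primes_prime[OF p] by (simp add: primes_coprime)
    then have "add.ord x dvd 1"
      using x1 x2 emb_eq_zero_iff[OF xc] by (metis coprime_common_divisor)
    then have "emb 1 \<otimes> x = \<zero>" using emb_eq_zero_iff[OF xc] by blast
    then show False using x(2) xc by simp
  qed
  obtain H where H: "subgroup H (add_monoid R)" "card H = p ^ a"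
    using sylow_thm[OF primes_prime[OF p] add.is_group, of a m] finite_carrier a(2) order_add_monoid by auto
  have "H \<subseteq> C" unfolding C_def by (rule sylow_subset_component) (use H a(1) in simp_all)
  then have le: "p ^ a \<le> card C" using H(2) fC by (metis card_mono)
  have "coprime (card C) m"
  proof (rule ccontr)
    assume "\<not> coprime (card C) m"
    then obtain q where q: "Factorial_Ring.prime q" "q dvd card C" "q dvd m"
      by (metis gcd_nat.bounded_iff coprime_iff_gcd_eq_1 prime_factor_nat)
    then have "q = p" using only_p by blast
    then show False using q a(3) by (metis coprime_common_divisor_nat dvd_refl not_prime_1)
  qed
  then have "card C dvd p ^ a" using dvd unfolding a(2) by (simp add: coprime_dvd_mult_left_iff)
  then have "card C \<le> p ^ a" using prime_gt_0_nat[OF primes_prime[OF p]] by (intro dvd_imp_le) simp_all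
  with le show ?thesis unfolding C_def a(1) by simp
qed

lemma sylow_part_eq:
  assumes p: "p \<in> primes"
  shows "sylow_part R p = component p"
  unfolding sylow_part_def
proof (rule the_equality)
  show "subgroup (component p) (add_monoid R) \<and> card (component p) = p ^ multiplicity p (order R)"
    using subgroup_component card_component[OF p] by blast
  fix H assume H: "subgroup H (add_monoid R) \<and> card H = p ^ multiplicity p (order R)"
  have "finite (component p)" using finite_carrier by (simp add: component_def)
  then show "H = component p"
    using H sylow_subset_component card_component[OF p] by (intro card_subset_eq) auto
qed

lemma idem_component: "p \<in> primes \<Longrightarrow> idem p \<in> component p"
  using idem_nilpotent by (simp add: component_def)

lemma component_one:
  assumes p: "p \<in> primes"
  shows "(THE e. e \<in> component p \<and> (\<forall>x\<in>component p. e \<otimes> x = x)) = idem p"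
proof (rule the_equality)
  show I: "idem p \<in> component p \<and> (\<forall>x\<in>component p. idem p \<otimes> x = x)"
    using idem_component[OF p] emb_annihilator[OF p] by (simp add: component_def)
  fix e assume e: "e \<in> component p \<and> (\<forall>x\<in>component p. e \<otimes> x = x)"
  then have ec: "e \<in> carrier R" by (simp add: component_def)
  have "e = idem p \<otimes> e" using I e by (simp only:)
  also have "\<dots> = e \<otimes> idem p" by (rule m_comm[OF idem_closed ec])
  also have "\<dots> = idem p" using I e by blast
  finally show "e = idem p" .
qed

text \<open>If the \<open>p\<close>-component \<open>z\<close> of \<open>x\<close> generates the
  whole component, it is invertible there. Otherwise \<open>z\<close> lies in the only maximal
  ideal, that is the radical, and is a multiple of \<open>p\<close>; the rest of \<open>x\<close> is
  one by \<open>idem_complement\<close>.\<close>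

lemma galois_component:
  assumes p: "p \<in> primes" and gal: "galois_ring p (ring_component R p)" and x: "x \<in> carrier R"
  shows "(\<exists>y\<in>carrier R. x = emb p \<otimes> y) \<or> (\<exists>w\<in>carrier R. x \<otimes> w \<otimes> idem p = idem p)"
proof (rule disjCI)
  assume nw: "\<not> (\<exists>w\<in>carrier R. x \<otimes> w \<otimes> idem p = idem p)"
  define Q where "Q = ring_component R p"
  have Qs: "carrier Q = component p" "monoid.mult Q = monoid.mult R" "ring.add Q = ring.add R" "ring.zero Q = \<zero>"
    "one Q = idem p" "add_pow Q k y = add_pow R k y" for k :: nat and y
    unfolding Q_def ring_component_def
    by (simp_all add: sylow_part_eq[OF p] component_one[OF p] add_pow_def nat_pow_def)
  have loc: "local_ring Q" and jac: "jacobson_radical Q = (\<lambda>y. add_pow Q p y) ` carrier Q"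
    using gal by (simp_all add: galois_ring_def Q_def)
  interpret Q: cring Q using loc by (simp add: local_ring_def)
  have CR: "y \<in> carrier R" if "y \<in> component p" for y using that by (simp add: component_def)
  define z where "z = idem p \<otimes> x"
  have z: "z \<in> component p"
    using x idem_nilpotent[OF p] by (simp add: z_def component_def flip: m_assoc)
  have finQ: "finite (carrier Q)" using finite_carrier by (simp add: Qs component_def)
  have "PIdl\<^bsub>Q\<^esub> z \<noteq> carrier Q"
  proof
    assume "PIdl\<^bsub>Q\<^esub> z = carrier Q"
    then have "idem p \<in> PIdl\<^bsub>Q\<^esub> z" using idem_component[OF p] by (simp add: Qs)
    then obtain r where r: "r \<in> component p" "idem p = r \<otimes> z" unfolding cgenideal_def by (auto simp: Qs)
    have "x \<otimes> r \<otimes> idem p = r \<otimes> z" using x CR[OF r(1)] by (simp add: z_def m_ac)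
    then have "x \<otimes> r \<otimes> idem p = idem p" by (simp only: r(2)[symmetric])
    then show False using nw CR[OF r(1)] by blast
  qed
  then obtain M where M: "maximalideal M Q" "PIdl\<^bsub>Q\<^esub> z \<subseteq> M"
    using Q.maximalideal_above[OF finQ Q.cgenideal_ideal] z by (auto simp: Qs)
  have uniq: "M' = M" if "maximalideal M' Q" for M'
    using loc that M(1) unfolding local_ring_def by blast
  have "z \<in> M" using M(2) Q.cgenideal_self[of z] z by (auto simp: Qs)
  then have "z \<in> jacobson_radical Q" unfolding jacobson_radical_def using uniq z by (auto simp: Qs)
  then obtain y where y: "y \<in> component p" "z = add_pow R p y" unfolding jac by (auto simp: Qs)
  then have zy: "z = emb p \<otimes> y" using CR by (simp add: emb_l_mult)
  obtain y' where y': "y' \<in> carrier R" "\<one> \<ominus> idem p = emb p \<otimes> y'" using idem_complement[OF p] by blast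
  have "x = idem p \<otimes> x \<oplus> (\<one> \<ominus> idem p) \<otimes> x"
  proof -
    have "x = e \<otimes> x \<oplus> (\<one> \<ominus> e) \<otimes> x" if "e \<in> carrier R" for e
      using that x add_diff_diff[of x "e \<otimes> x" \<zero>] by (simp add: a_minus_def l_distr l_minus a_lcomm r_neg)
    then show ?thesis by blast
  qed
  also have "\<dots> = emb p \<otimes> (y \<oplus> y' \<otimes> x)"
    unfolding y'(2) z_def[symmetric] zy using CR[OF y(1)] y'(1) x by (simp add: r_distr m_assoc)
  finally show "\<exists>y\<in>carrier R. x = emb p \<otimes> y" using CR[OF y(1)] y'(1) x by blast
qed

text \<open>If 2 were in \<open>primes\<close>, a non-zero element of its socle would be killed by 2
  and by the odd characteristic.\<close>

lemma odd_primes_char: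
  assumes "odd (ring_char R)" "p \<in> primes"
  shows "odd p"
proof
  assume "even p"
  then have p2: "2 = p"
    by (rule primes_dvd_imp_eq[OF two_is_prime_nat primes_prime[OF assms(2)]])
  obtain x where x: "x \<in> socle p" "x \<noteq> \<zero>" by (rule socle_nontrivial[OF assms(2)])
  have xc: "x \<in> carrier R" using x by blast
  obtain k where k: "ring_char R = 2 * k + 1" using assms(1) by (rule oddE)
  have "emb (ring_char R) = \<zero>"
    using add.pow_ord_eq_1[of \<one>] by (simp add: emb_def ring_char_def add_pow_def)
  then have "emb (2 * k + 1) \<otimes> x = \<zero>" using k xc by simp
  moreover have "emb (2 * k) \<otimes> x = \<zero>" using socle_emb_dvd[OF x(1), of "2 * k"] by (simp flip: p2)
  ultimately show False using x(2) xc emb_add[of "2 * k" 1] by (simp add: l_distr)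
qed

end

lemma CG_ring_odd_cg_ring:
  assumes "CG_ring R" "odd (ring_char R)"
  shows "odd_cg_ring R"
proof -
  interpret cring R using assms(1) by (simp add: CG_ring_def)
  interpret finite_cring R by unfold_locales (use assms(1) in \<open>simp add: CG_ring_def\<close>)
  show ?thesis
  proof
    show "odd p" if "p \<in> primes" for p by (rule odd_primes_char[OF assms(2) that])
    show "(\<exists>y\<in>carrier R. x = emb p \<otimes>\<^bsub>R\<^esub> y) \<or> (\<exists>w\<in>carrier R. x \<otimes>\<^bsub>R\<^esub> w \<otimes>\<^bsub>R\<^esub> idem p = idem p)"
      if "p \<in> primes" "x \<in> carrier R" for p x
      using that assms(1) by (intro galois_component) (simp_all add: CG_ring_def primes_def)
  qed
qed

text \<open>Elements of \<open>A\<close> are combinations of indicators of basic sets, hence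
  constant on each of them. The product of two indicators lies in \<open>A\<close>, and its
  coefficients count representations.\<close>

lemma S_ring_mult_constant:
  fixes G (structure)
  assumes S: "S_ring G A S" and YZ: "Y \<in> S" "Z \<in> S" and W: "W \<in> S" "w \<in> W" "w' \<in> W"
  shows "(\<Sum>y\<in>Y. \<Sum>z\<in>Z. if y \<otimes>\<^bsub>G\<^esub> z = w then 1 else 0 :: 'b::ring_1) =
    (\<Sum>y\<in>Y. \<Sum>z\<in>Z. if y \<otimes>\<^bsub>G\<^esub> z = w' then 1 else 0)"
proof -
  interpret group G using S by (simp add: S_ring_def)
  have fin: "finite (carrier G)" and sub: "subring A (int_group_ring G)" and part: "partition_on (carrier G) S"
    and basis: "is_int_basis A (indicator ` S)"
    using S by (simp_all add: S_ring_def)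
  have SG: "B \<subseteq> carrier G" if "B \<in> S" for B using partition_onD1[OF part] that by blast
  have const: "f w = f w'" if f: "f \<in> A" for f
  proof -
    obtain c where c: "f = (\<lambda>x. \<Sum>b\<in>indicator ` S. c b * b x)"
      using basis f unfolding is_int_basis_def by blast
    have "indicator B w = (indicator B w' :: int)" if "B \<in> S" for B
      using partition_onD2[OF part] that W unfolding disjoint_def by (auto simp: indicator_def)
    then show ?thesis unfolding c by (intro sum.cong refl) auto
  qed
  define g where "g = indicator Y \<otimes>\<^bsub>int_group_ring G\<^esub> (indicator Z :: _ \<Rightarrow> int)"
  have "indicator Y \<in> A" "indicator Z \<in> A" using basis YZ by (auto simp: is_int_basis_def)
  then have "g \<in> A" unfolding g_def using subringE(6)[OF sub] by blast
  have g: "g v = (\<Sum>y\<in>Y. \<Sum>z\<in>Z. if y \<otimes> z = v then 1 else 0)" for v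
  proof -
    have "g v = (\<Sum>u\<in>carrier G \<times> carrier G. if fst u \<otimes> snd u = v then indicator Y (fst u) * indicator Z (snd u) else 0)"
      unfolding g_def int_group_ring_def using fin
      by (simp add: sum.If_cases case_prod_unfold) (rule sum.cong, auto)
    also have "\<dots> = (\<Sum>y\<in>carrier G. \<Sum>z\<in>carrier G. if y \<otimes> z = v then indicator Y y * indicator Z z else 0)"
      unfolding sum.cartesian_product by (simp add: case_prod_unfold)
    also have "\<dots> = (\<Sum>y\<in>Y. \<Sum>z\<in>carrier G. if y \<otimes> z = v then indicator Y y * indicator Z z else 0)"
      using fin SG[OF YZ(1)] by (intro sum.mono_neutral_right) (auto intro!: sum.neutral)
    also have "\<dots> = (\<Sum>y\<in>Y. \<Sum>z\<in>Z. if y \<otimes> z = v then 1 else 0)"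
    proof (rule sum.cong[OF refl])
      fix y assume "y \<in> Y"
      then show "(\<Sum>z\<in>carrier G. if y \<otimes> z = v then indicator Y y * indicator Z z else 0) =
        (\<Sum>z\<in>Z. if y \<otimes> z = v then 1 else (0::int))"
        using fin SG[OF YZ(2)] by (intro sum.mono_neutral_cong_right) auto
    qed
    finally show ?thesis .
  qed
  have "(\<Sum>y\<in>Y. \<Sum>z\<in>Z. if y \<otimes> z = v then 1 else 0 :: 'b) = of_int (g v)" for v
    unfolding g by (simp add: if_distrib cong: if_cong)
  then show ?thesis using const[OF \<open>g \<in> A\<close>] by simp
qed

text \<open>\<open>GREATEST\<close> needs a greatest ideal to exist: the sum of two stabilising
  ideals stabilises \<open>Y\<close>, so a maximal one in the finite family contains all
  others.\<close>

lemma (in finite_cring) ideal_subset_I_L: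
  assumes Y: "Y \<subseteq> carrier R" and I: "ideal I R" "Y <+>\<^bsub>R\<^esub> I = Y"
  shows "I \<subseteq> I_L R Y"
proof -
  define C where "C = {I. ideal I R \<and> Y <+>\<^bsub>R\<^esub> I = Y}"
  have sub: "I \<subseteq> carrier R" if "ideal I R" for I
    using additive_subgroup.a_subset[OF ideal.axioms(1)[OF that]] .
  have zero: "\<zero> \<in> I" if "ideal I R" for I
    using additive_subgroup.zero_closed[OF ideal.axioms(1)[OF that]] .
  have "C \<subseteq> Set.Pow (carrier R)" using sub by (auto simp: C_def)
  then have "finite C" using finite_carrier by (meson finite_Pow_iff finite_subset)
  moreover have "I \<in> C" using I by (simp add: C_def)
  ultimately obtain G where G: "G \<in> C" "\<forall>I\<in>C. G \<subseteq> I \<longrightarrow> G = I"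
    using finite_has_maximal[of C] by blast
  have top: "I \<subseteq> G" if "I \<in> C" for I
  proof -
    have Gi: "ideal G R" "Y <+>\<^bsub>R\<^esub> G = Y" and Ii: "ideal I R" "Y <+>\<^bsub>R\<^esub> I = Y" using G that by (simp_all add: C_def)
    have "Y <+>\<^bsub>R\<^esub> (G <+>\<^bsub>R\<^esub> I) = Y <+>\<^bsub>R\<^esub> G <+>\<^bsub>R\<^esub> I"
      using add.set_mult_assoc[of Y G I] Y sub[OF Gi(1)] sub[OF Ii(1)] by (simp add: set_add_def)
    then have "G <+>\<^bsub>R\<^esub> I \<in> C"
      using add_ideals[OF Gi(1) Ii(1)] Gi(2) Ii(2) by (simp add: C_def)
    moreover have "G \<subseteq> G <+>\<^bsub>R\<^esub> I"
      using zero[OF Ii(1)] sub[OF Gi(1)] unfolding set_add_def' by force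
    moreover have "I \<subseteq> G <+>\<^bsub>R\<^esub> I"
      using zero[OF Gi(1)] sub[OF Ii(1)] unfolding set_add_def' by force
    ultimately show ?thesis using G(2) by blast
  qed
  have "I_L R Y = G"
    unfolding I_L_def using G(1) top by (intro Greatest_equality) (auto simp: C_def)
  then show ?thesis using top \<open>I \<in> C\<close> by simp
qed

text \<open>Units map \<open>socle p\<close> into itself. So if \<open>K\<close> contained the whole
  translate of \<open>socle p\<close> by \<one>, its multiple \<open>Y\<close> would be stable under
  adding \<open>socle p\<close>, forcing this non-zero ideal into \<open>I_L R Y\<close>.\<close>

lemma (in dense_partition) pure_no_socle_coset:
  assumes Y: "Y \<in> S" "Y \<inter> Units R \<noteq> {}" and IL: "I_L R Y = {\<zero>}" and p: "p \<in> primes"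
  shows "\<exists>h\<in>socle p. \<one> \<oplus> h \<notin> K"
proof (rule ccontr)
  assume "\<not> (\<exists>h\<in>socle p. \<one> \<oplus> h \<notin> K)"
  then have K1: "\<one> \<oplus> h \<in> K" if "h \<in> socle p" for h using that by blast
  obtain u where u: "u \<in> Y" "u \<in> Units R" using Y by blast
  have YK: "Y = (\<otimes>) u ` K"
    using block_eq[OF Y(1) u(1)] block_unit[OF u(2) one_closed] Units_closed[OF u(2)] by (simp add: K_def)
  have YR: "Y \<subseteq> carrier R" by (rule S_subset[OF Y(1)])
  have "y \<oplus> h \<in> Y" if y: "y \<in> Y" and h: "h \<in> socle p" for y h
  proof -
    obtain k where k: "k \<in> K" "y = u \<otimes> k" using y YK by blast
    have ku: "k \<in> Units R" by (rule unit_groupD(1)[OF unit_group_K k(1)])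
    have yu: "y \<in> Units R" unfolding k(2) using u(2) ku by (rule Units_m_closed)
    have hc: "h \<in> carrier R" using h by blast
    have "inv y \<otimes> h \<in> socle p" using h yu by auto
    then have "k \<otimes> (\<one> \<oplus> inv y \<otimes> h) \<in> K" using K1 k(1) unit_groupD(4)[OF unit_group_K] by blast
    moreover have "y \<oplus> h = u \<otimes> (k \<otimes> (\<one> \<oplus> inv y \<otimes> h))"
    proof -
      have "u \<otimes> (k \<otimes> (\<one> \<oplus> inv y \<otimes> h)) = y \<otimes> (\<one> \<oplus> inv y \<otimes> h)"
        unfolding k(2) using u(2) ku hc yu[unfolded k(2)] by (simp add: m_assoc Units_closed)
      also have "\<dots> = y \<oplus> (y \<otimes> inv y) \<otimes> h" using yu hc by (simp add: r_distr m_assoc Units_closed del: Units_r_inv)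
      finally show ?thesis using yu hc by simp
    qed
    ultimately show ?thesis unfolding YK by blast
  qed
  then have sub: "Y <+>\<^bsub>R\<^esub> socle p \<subseteq> Y" unfolding set_add_def' by blast
  have sup: "Y \<subseteq> Y <+>\<^bsub>R\<^esub> socle p"
  proof
    fix y assume y: "y \<in> Y"
    then have "y = y \<oplus> \<zero>" using YR by (simp add: subset_iff)
    then show "y \<in> Y <+>\<^bsub>R\<^esub> socle p" unfolding set_add_def' using y socle_zero by blast
  qed
  have "socle p \<subseteq> I_L R Y"
    by (rule ideal_subset_I_L[OF YR socle_ideal equalityI[OF sub sup]])
  moreover obtain h where "h \<in> socle p" "h \<noteq> \<zero>" by (rule socle_nontrivial[OF p])
  ultimately show False using IL by blast
qed

lemma (in dense_pure_partition) cyclotomic: "cyclotomic_basic_sets R S"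
  unfolding cyclotomic_basic_sets_def
proof (intro exI conjI)
  show "subgroup K (units_of R)"
  proof (rule group.subgroupI[OF units_group])
    show "K \<subseteq> carrier (units_of R)" using unit_groupD(1)[OF unit_group_K] by (auto simp: units_of_carrier)
    show "K \<noteq> {}" using unit_groupD(3)[OF unit_group_K] by blast
    show "inv\<^bsub>units_of R\<^esub> a \<in> K" if "a \<in> K" for a
      using that unit_groupD(1,5)[OF unit_group_K] by (simp add: units_of_inv)
    show "a \<otimes>\<^bsub>units_of R\<^esub> b \<in> K" if "a \<in> K" "b \<in> K" for a b
      using that unit_groupD(4)[OF unit_group_K] by (simp add: units_of_mult)
  qed
  have orb: "orbit ((units_of R)\<lparr>carrier := K\<rparr>) (\<lambda>u x. u \<otimes> x) x = block x" if "x \<in> carrier R" for x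
    unfolding orbit_def block_eq_orbit[OF that]
    using unit_groupD(2)[OF unit_group_K] m_comm[OF that] by auto
  have "S = block ` carrier R"
  proof
    show "S \<subseteq> block ` carrier R"
    proof
      fix B assume B: "B \<in> S"
      then have "B \<noteq> {}" using partition_onD3[OF partS] by blast
      then obtain x where x: "x \<in> B" by blast
      show "B \<in> block ` carrier R"
        using block_eq[OF B x, symmetric] subsetD[OF S_subset[OF B] x] by (rule image_eqI)
    qed
  qed (use block_mem in blast)
  also have "\<dots> = orbits ((units_of R)\<lparr>carrier := K\<rparr>) (carrier R) (\<lambda>u x. u \<otimes> x)"
    unfolding orbits_def Setcompr_eq_image Collect_mem_eq by (rule image_cong[OF refl orb[symmetric]])
  finally show "S = orbits ((units_of R)\<lparr>carrier := K\<rparr>) (carrier R) (\<lambda>u x. u \<otimes> x)" .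
qed

theorem theorem9p1:
  fixes R :: "('a, 'm) ring_scheme"
    and A :: "('a \<Rightarrow> int) set"
    and S :: "'a set set"
  assumes "CG_ring R"
    and "odd (ring_char R)"
    and "S_ring_over_ring R A S"
    and "dense_basic_sets R S"
    and "pure_basic_sets R S"
  shows "cyclotomic_basic_sets R S"
proof -
  interpret odd_cg_ring R by (rule CG_ring_odd_cg_ring[OF assms(1,2)])
  obtain \<chi> where \<chi>: "odd_cg_ring_char R \<chi>" by (rule odd_cg_ring_char_ex)
  have S: "S_ring (add_monoid R) A S" and U: "\<And>Y u. Y \<in> S \<Longrightarrow> u \<in> Units R \<Longrightarrow> u <#\<^bsub>R\<^esub> Y \<in> S"
    using assms(3) by (simp_all add: S_ring_over_ring_def)
  have dense: "dense_partition R \<chi> S"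
  proof (intro dense_partition.intro dense_partition_axioms.intro \<chi>)
    have "partition_on (carrier (add_monoid R)) S" "{\<one>\<^bsub>add_monoid R\<^esub>} \<in> S"
      using S unfolding S_ring_def by blast+
    then show "partition_on (carrier R) S" "{\<zero>\<^bsub>R\<^esub>} \<in> S"
      by (simp_all only: partial_object.select_convs(1) monoid.select_convs(2))
    show "(\<otimes>\<^bsub>R\<^esub>) u ` Y \<in> S" if "Y \<in> S" "u \<in> Units R" for u Y
      using U[OF that] unfolding l_coset_def UNION_singleton_eq_range .
    show "\<exists>T\<subseteq>S. I = \<Union>T" if "ideal I R" for I
      using assms(4) that unfolding dense_basic_sets_def by blast
    show "(\<Sum>x\<in>Y. \<Sum>y\<in>Z. if x \<oplus>\<^bsub>R\<^esub> y = z then 1 else 0 :: complex) =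
      (\<Sum>x\<in>Y. \<Sum>y\<in>Z. if x \<oplus>\<^bsub>R\<^esub> y = z' then 1 else 0)"
      if "Y \<in> S" "Z \<in> S" "W \<in> S" "z \<in> W" "z' \<in> W" for Y Z W z z'
      using S_ring_mult_constant[OF S that, where 'b = complex] by (simp only: monoid.select_convs(1))
  qed
  obtain Y where Y: "Y \<in> S" "Y \<inter> Units R \<noteq> {}" "I_L R Y = {\<zero>\<^bsub>R\<^esub>}"
    using assms(5) unfolding pure_basic_sets_def by (elim bexE conjE)
  have "dense_pure_partition R \<chi> S"
    by (intro dense_pure_partition.intro dense_pure_partition_axioms.intro dense
        dense_partition.pure_no_socle_coset[OF dense Y])
  then show ?thesis by (rule dense_pure_partition.cyclotomic)
qed

end
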